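(* Let $t_0\ge0$, $m\ge1$, and let $a,g,b_k,h_k:[0,\infty)\to\mathbb R$ ($k=1,\dots,m$) be Lebesgue measurable functions such that $a,b_k$ are essentially bounded on $[0,\infty)$; $\operatorname{ess\,sup}_{t\ge t_0}|a(t)|\le a_0$ for some constant $a_0<1$; $b_k(t)\ge0$ for $t\ge t_0$; $0\le t-g(t)\le\delta$ and $0\le t-h_k(t)\le\tau_k$ with constants $\delta,\tau_k$; and the set $g^{-1}(E)$ has Lebesgue measure zero whenever $E\subset\mathbb R$ has Lebesgue measure zero. Suppose there exist $b_0>0$ and a set of indexes $J\subseteq\{1,\dots,m\}$ such that $b(t):=\sum_{k\in J}b_k(t)\ge b_0$ for $t\ge t_0$ and $$\left(\left\|\frac ab\right\|+\sum_{k\in J}\left\|\frac{b_k}{b}\right\|\left\|t-h_k(t)-\frac1{Be}\right\|\right)\frac{\sum_{k=1}^m\|b_k\|}{1-\|a\|}+\sum_{k\notin J}\left\|\frac{b_k}{b}\right\|<1,$$ where $B=\sum_{k\in J}\|b_k\|$. Then the equation $\dot x(t)-a(t)\dot x(g(t))=-\sum_{k=1}^m b_k(t)x(h_k(t))$ is exponentially stable.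
   Context: Notation: $\|f\|=\|f\|_{[t_0,\infty)}=\operatorname{ess\,sup}_{t\ge t_0}|f(t)|$ (an expression in $t$ inside the norm denotes the corresponding function of $t$). Solutions: for an initial point $\sigma\ge t_0$ and bounded Borel measurable functions $\varphi:(-\infty,\sigma]\to\mathbb R$, $\psi:(-\infty,\sigma)\to\mathbb R$ (prescribed independently of each other), a solution of the equation with initial conditions $x(t)=\varphi(t)$ for $t\le\sigma$, $\dot x(t)=\psi(t)$ for $t<\sigma$ is a function $x$ that is absolutely continuous on each $[\sigma,c]$, has locally essentially bounded derivative on $[\sigma,\infty)$, and satisfies the equation for almost all $t\ge\sigma$, where $x$ at arguments $\le\sigma$ is replaced by $\varphi$ and $\dot x$ at arguments $<\sigma$ is replaced by $\psi$. The equation is (uniformly) exponentially stable if there exist $M>0$, $\gamma>0$, not depending on $\sigma\ge t_0$, $\varphi$, $\psi$, such that every such solution satisfies $|x(t)|\le M e^{-\gamma(t-\sigma)}\sup_{s\le\sigma}(|\varphi(s)|+|\psi(s)|)$ for $t\ge\sigma$ (with $\psi(\sigma):=0$). *)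

theory Defs
  imports "HOL-Analysis.Analysis" "HOL-Probability.Essential_Supremum"
begin

definition ess_bounded_on :: "real set \<Rightarrow> (real \<Rightarrow> real) \<Rightarrow> bool" where
  "ess_bounded_on S f \<longleftrightarrow>
     f \<in> borel_measurable (lebesgue_on S) \<and> (\<exists>K. AE t in lebesgue_on S. \<bar>f t\<bar> \<le> K)"

text \<open>The norm of \<open>L\<^sup>\<infinity>[t0, \<infinity>)\<close>. Being real-valued, it is the essential supremum only
  for functions that are essentially bounded on \<open>[t0, \<infinity>)\<close>; for all others it is \<open>0\<close>.\<close>

definition ess_norm :: "real \<Rightarrow> (real \<Rightarrow> real) \<Rightarrow> real" where
  "ess_norm t0 f = real_of_ereal (esssup (lebesgue_on {t0..}) (\<lambda>t. ereal \<bar>f t\<bar>))"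

text \<open>Absolute continuity of a function on \<open>[u, v]\<close>; the library's \<^const>\<open>absolutely_continuous\<close>
  is the notion for measures.\<close>

definition abs_continuous_on_interval :: "(real \<Rightarrow> real) \<Rightarrow> real \<Rightarrow> real \<Rightarrow> bool" where
  "abs_continuous_on_interval x u v \<longleftrightarrow>
     (\<forall>\<epsilon>>0. \<exists>\<eta>>0. \<forall>(n::nat) l r.
        (\<forall>i<n. u \<le> l i \<and> l i \<le> r i \<and> r i \<le> v) \<longrightarrow>
        disjoint_family_on (\<lambda>i. {l i<..<r i}) {..<n} \<longrightarrow>
        (\<Sum>i<n. r i - l i) < \<eta> \<longrightarrow>
        (\<Sum>i<n. \<bar>x (r i) - x (l i)\<bar>) < \<epsilon>)"

text \<open>The initial data \<open>\<phi>\<close> on \<open>(-\<infinity>, \<sigma>]\<close> and \<open>\<psi>\<close> on \<open>(-\<infinity>, \<sigma>)\<close>; their values elsewhere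
  are irrelevant.\<close>

definition initial_data :: "real \<Rightarrow> (real \<Rightarrow> real) \<Rightarrow> (real \<Rightarrow> real) \<Rightarrow> bool" where
  "initial_data \<sigma> \<phi> \<psi> \<longleftrightarrow>
     \<phi> \<in> borel_measurable (restrict_space borel {..\<sigma>}) \<and> bounded (\<phi> ` {..\<sigma>}) \<and>
     \<psi> \<in> borel_measurable (restrict_space borel {..<\<sigma>}) \<and> bounded (\<psi> ` {..<\<sigma>})"

text \<open>A solution of \<open>x'(t) - a(t) x'(g(t)) = - (\<Sum>k=1..m. b k t * x (h k t))\<close>. Here \<open>x\<close> lives on the
  whole line and agrees with \<open>\<phi>\<close> on \<open>(-\<infinity>, \<sigma>]\<close>, whereas \<open>\<psi>\<close> need not be the derivative of \<open>\<phi>\<close>,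
  so the delayed derivative is chosen by cases. For \<open>t > \<sigma>\<close> the number \<open>deriv x t\<close> depends only
  on the values of \<open>x\<close> on \<open>(\<sigma>, \<infinity>)\<close>. It is meaningless at \<open>\<sigma>\<close> and at points of
  non-differentiability; when preimages of null sets under \<open>g\<close> are null, these affect the equation
  only on a null set of \<open>t\<close>.\<close>

definition neutral_solution ::
  "nat \<Rightarrow> (real \<Rightarrow> real) \<Rightarrow> (real \<Rightarrow> real) \<Rightarrow> (nat \<Rightarrow> real \<Rightarrow> real) \<Rightarrow> (nat \<Rightarrow> real \<Rightarrow> real) \<Rightarrow>
   real \<Rightarrow> (real \<Rightarrow> real) \<Rightarrow> (real \<Rightarrow> real) \<Rightarrow> (real \<Rightarrow> real) \<Rightarrow> bool" where
  "neutral_solution m a g b h \<sigma> \<phi> \<psi> x \<longleftrightarrow>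
     (\<forall>t\<le>\<sigma>. x t = \<phi> t) \<and>
     (\<forall>c\<ge>\<sigma>. abs_continuous_on_interval x \<sigma> c) \<and>
     (\<forall>c\<ge>\<sigma>. (AE t in lebesgue_on {\<sigma>..c}. x differentiable (at t)) \<and>
            ess_bounded_on {\<sigma>..c} (deriv x)) \<and>
     (AE t in lebesgue_on {\<sigma>..}.
        deriv x t - a t * (if g t < \<sigma> then \<psi> (g t) else deriv x (g t))
          = - (\<Sum>k=1..m. b k t * x (h k t)))"

definition exponentially_stable ::
  "real \<Rightarrow> nat \<Rightarrow> (real \<Rightarrow> real) \<Rightarrow> (real \<Rightarrow> real) \<Rightarrow> (nat \<Rightarrow> real \<Rightarrow> real) \<Rightarrow> (nat \<Rightarrow> real \<Rightarrow> real) \<Rightarrow> bool" where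
  "exponentially_stable t0 m a g b h \<longleftrightarrow>
     (\<exists>M>0. \<exists>\<gamma>>0. \<forall>\<sigma>\<ge>t0. \<forall>\<phi> \<psi> x.
        initial_data \<sigma> \<phi> \<psi> \<longrightarrow> neutral_solution m a g b h \<sigma> \<phi> \<psi> x \<longrightarrow>
        (\<forall>t\<ge>\<sigma>. \<bar>x t\<bar> \<le> M * exp (- \<gamma> * (t - \<sigma>)) *
                   (SUP s\<in>{..\<sigma>}. \<bar>\<phi> s\<bar> + (if s < \<sigma> then \<bar>\<psi> s\<bar> else 0))))"

end

theory Submission
  imports Defs
begin

text \<open>All estimates are made for one given solution \<open>x\<close> on \<open>[\<sigma>, T]\<close> in the weighted norm
  \<open>sup exp (\<gamma> (t - \<sigma>)) |\<cdot>|\<close>, with constants independent of \<open>T\<close>, \<open>\<sigma>\<close> and the initial data.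
  The equation itself bounds \<open>x'\<close> by \<open>\<Sum>\<parallel>b\<^sub>k\<parallel> / (1 - \<parallel>a\<parallel>)\<close> times the bound of \<open>x\<close>.
  With \<open>r = 1 / (B e)\<close> the equation reads \<open>x'(t) + b(t) x(t - r) = f(t)\<close>, where
  \<open>f(t) = a(t) x'(g(t)) + \<Sum>\<^bsub>k \<in> J\<^esub> b\<^sub>k(t) (x(t - r) - x(h\<^sub>k(t))) - \<Sum>\<^bsub>k \<notin> J\<^esub> b\<^sub>k(t) x(h\<^sub>k(t))\<close> and the
  differences are controlled by the bound of \<open>x'\<close>. Because \<open>b \<le> B\<close> and \<open>r B = 1 / e\<close>, the left-hand
  side satisfies a comparison principle: \<open>|f| \<le> b F\<close> implies \<open>|x| \<le> max F |x(\<sigma>)|\<close>. The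
  hypothesis makes the resulting estimate of \<open>x\<close> by itself a contraction when \<open>\<gamma>\<close> is small.
  The initial function need not be continuous, so \<open>x(t - r)\<close> is replaced by \<open>x(max (t - r) \<sigma>)\<close>, the
  history frozen at \<open>x(\<sigma>)\<close>; the error is bounded by the initial data and occurs only during one
  delay after \<open>\<sigma>\<close>.\<close>

section \<open>Absolutely continuous functions: monotonicity and increments from the a.e.
  derivative\<close>

text \<open>Reindexing by a bijection with an initial segment of the naturals makes the definition
  applicable to the members of a tagged division.\<close>

lemma abs_continuous_on_interval_finite_family:
  assumes "abs_continuous_on_interval f u v" and "\<epsilon> > 0"
  shows "\<exists>\<eta>>0. \<forall>(P :: 'i set) l r. finite P \<longrightarrow> (\<forall>i\<in>P. u \<le> l i \<and> l i \<le> r i \<and> r i \<le> v) \<longrightarrow>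
           disjoint_family_on (\<lambda>i. {l i<..<r i}) P \<longrightarrow> (\<Sum>i\<in>P. r i - l i) < \<eta> \<longrightarrow>
           (\<Sum>i\<in>P. \<bar>f (r i) - f (l i)\<bar>) < \<epsilon>"
proof -
  obtain \<eta> where "\<eta> > 0" and \<eta>: "\<And>(n::nat) l r. (\<forall>i<n. u \<le> l i \<and> l i \<le> r i \<and> r i \<le> v) \<Longrightarrow>
        disjoint_family_on (\<lambda>i. {l i<..<r i}) {..<n} \<Longrightarrow> (\<Sum>i<n. r i - l i) < \<eta> \<Longrightarrow>
        (\<Sum>i<n. \<bar>f (r i) - f (l i)\<bar>) < \<epsilon>"
    using assms unfolding abs_continuous_on_interval_def by blast
  show ?thesis
  proof (intro exI[of _ \<eta>] conjI allI impI \<open>\<eta> > 0\<close>)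
    fix P :: "'i set" and l r :: "'i \<Rightarrow> real"
    assume P: "finite P" "\<forall>i\<in>P. u \<le> l i \<and> l i \<le> r i \<and> r i \<le> v"
      and disj: "disjoint_family_on (\<lambda>i. {l i<..<r i}) P" and less: "(\<Sum>i\<in>P. r i - l i) < \<eta>"
    obtain e where e: "bij_betw e {..<card P} P"
      using ex_bij_betw_nat_finite[OF P(1)] by (auto simp: atLeast0LessThan)
    have reindex: "(\<Sum>i\<in>P. F i) = (\<Sum>i<card P. F (e i))" for F :: "'i \<Rightarrow> real"
      by (rule sum.reindex_bij_betw[OF e, symmetric])
    have "disjoint_family_on (\<lambda>i. {l (e i)<..<r (e i)}) {..<card P}"
      using disj e unfolding disjoint_family_on_def bij_betw_def inj_on_def by blast
    moreover have "\<forall>i<card P. u \<le> l (e i) \<and> l (e i) \<le> r (e i) \<and> r (e i) \<le> v"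
      using P(2) e by (auto simp: bij_betw_def)
    ultimately show "(\<Sum>i\<in>P. \<bar>f (r i) - f (l i)\<bar>) < \<epsilon>"
      using \<eta>[of "card P" "\<lambda>i. l (e i)" "\<lambda>i. r (e i)"] less unfolding reindex by simp
  qed
qed

text \<open>Disjointness of the open intervals makes their lengths add up to the measure of their
  union, which lies in \<open>U\<close>.\<close>

lemma sum_length_disjoint_intervals_le:
  fixes l r :: "'i \<Rightarrow> real"
  assumes "finite P" "\<And>i. i \<in> P \<Longrightarrow> l i \<le> r i"
    and "disjoint_family_on (\<lambda>i. {l i<..<r i}) P"
    and "\<And>i. i \<in> P \<Longrightarrow> {l i<..<r i} \<subseteq> U" "U \<in> sets lebesgue"
  shows "ennreal (\<Sum>i\<in>P. r i - l i) \<le> emeasure lebesgue U"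
proof -
  have "ennreal (\<Sum>i\<in>P. r i - l i) = (\<Sum>i\<in>P. ennreal (r i - l i))"
    by (rule sum_ennreal[symmetric]) (use assms(2) in auto)
  also have "\<dots> = (\<Sum>i\<in>P. emeasure lebesgue {l i<..<r i})"
    using assms(2) by (intro sum.cong) auto
  also have "\<dots> = emeasure lebesgue (\<Union>i\<in>P. {l i<..<r i})"
    by (rule sum_emeasure) (use assms in auto)
  also have "\<dots> \<le> emeasure lebesgue U"
    by (rule emeasure_mono) (use assms in auto)
  finally show ?thesis .
qed

text \<open>The straddle estimate: the first-order expansions at \<open>t\<close> are taken to both
  sides and subtracted. Since \<open>l\<close> and \<open>r\<close> enclose \<open>t\<close>, the
  two errors add up to at most \<open>\<epsilon> * (r - l)\<close>.\<close>

lemma nonpos_deriv_straddle: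
  fixes f :: "real \<Rightarrow> real"
  assumes "(f has_real_derivative D) (at t)" "D \<le> 0" "\<epsilon> > 0"
  obtains d where "d > 0"
    and "\<And>l r. l \<le> t \<Longrightarrow> t \<le> r \<Longrightarrow> t - l < d \<Longrightarrow> r - t < d \<Longrightarrow> f r - f l \<le> \<epsilon> * (r - l)"
proof -
  have "(f has_derivative (\<lambda>h. D * h)) (at t)"
    using assms(1) by (simp add: has_field_derivative_def)
  then obtain d where "d > 0" and d: "\<And>s. norm (s - t) < d \<Longrightarrow> norm (f s - f t - D * (s - t)) \<le> \<epsilon> * norm (s - t)"
    using assms(3) unfolding has_derivative_at_alt by meson
  show ?thesis
  proof (rule that[OF \<open>d > 0\<close>])
    fix l r assume lr: "l \<le> t" "t \<le> r" "t - l < d" "r - t < d"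
    have "\<bar>f r - f t - D * (r - t)\<bar> \<le> \<epsilon> * (r - t)" "\<bar>f l - f t - D * (l - t)\<bar> \<le> \<epsilon> * (t - l)"
      using d[of r] d[of l] lr by auto
    then have "f r - f l \<le> D * (r - l) + \<epsilon> * (r - l)"
      by (simp add: algebra_simps abs_le_iff)
    moreover have "D * (r - l) \<le> 0"
      using assms(2) lr by (intro mult_nonpos_nonneg) auto
    ultimately show "f r - f l \<le> \<epsilon> * (r - l)" by simp
  qed
qed

text \<open>Over a fine tagged division, intervals whose tag lies outside the exceptional null set are
  handled by differentiability, the others have small total length and hence contribute little by
  absolute continuity.\<close>

lemma abs_continuous_nonpos_deriv_antimono:
  assumes ac: "abs_continuous_on_interval f u v" and "u \<le> v"
    and ae: "AE t in lebesgue. t \<in> {u..v} \<longrightarrow> (\<exists>D\<le>0. (f has_real_derivative D) (at t))"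
  shows "f v \<le> f u"
proof -
  have "f v - f u \<le> \<epsilon> * (v - u) + \<epsilon>" if "\<epsilon> > 0" for \<epsilon>
  proof -
    obtain N where N: "N \<in> null_sets lebesgue"
      "\<And>t. t \<in> {u..v} \<Longrightarrow> t \<notin> N \<Longrightarrow> \<exists>D\<le>0. (f has_real_derivative D) (at t)"
      using ae unfolding eventually_ae_filter by fastforce
    obtain \<eta> where \<eta>: "\<eta> > 0"
      "\<forall>(P :: (real \<times> real set) set) l r. finite P \<longrightarrow> (\<forall>i\<in>P. u \<le> l i \<and> l i \<le> r i \<and> r i \<le> v) \<longrightarrow>
           disjoint_family_on (\<lambda>i. {l i<..<r i}) P \<longrightarrow> (\<Sum>i\<in>P. r i - l i) < \<eta> \<longrightarrow>
           (\<Sum>i\<in>P. \<bar>f (r i) - f (l i)\<bar>) < \<epsilon>"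
      using abs_continuous_on_interval_finite_family[OF ac \<open>\<epsilon> > 0\<close>] by (elim exE conjE) (rule that)
    \<comment> \<open>An open superset of the null set \<open>N\<close> with measure below \<eta>:
      intervals inside \<open>U\<close> are short enough in total for absolute continuity.\<close>
    obtain U where U: "open U" "N \<subseteq> U" "emeasure lebesgue (U - N) < ennreal \<eta>"
      by (rule sets_lebesgue_outer_open[of N \<eta>]) (use N(1) \<eta>(1) in auto)
    have U_small: "emeasure lebesgue U < ennreal \<eta>"
      using U(3) emeasure_Diff_null_set[OF N(1), of U] U(1) by simp
    define good where "good t d \<longleftrightarrow> d > 0 \<and>
      (\<forall>l r. l \<le> t \<longrightarrow> t \<le> r \<longrightarrow> t - l < d \<longrightarrow> r - t < d \<longrightarrow> f r - f l \<le> \<epsilon> * (r - l))" for t d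
    have good: "\<exists>d. good t d" if t: "t \<in> {u..v}" "t \<notin> N" for t
    proof -
      obtain D where "D \<le> 0" "(f has_real_derivative D) (at t)" using N(2)[OF t] by blast
      from nonpos_deriv_straddle[OF this(2,1) \<open>\<epsilon> > 0\<close>] show ?thesis
        unfolding good_def by metis
    qed
    then obtain d where d: "\<And>t. t \<in> {u..v} \<Longrightarrow> t \<notin> N \<Longrightarrow> good t (d t)"
      by metis
    \<comment> \<open>A tag in \<open>N\<close> forces its interval into \<open>U\<close>; any other
      tag in [u, v] forces it into the range of the straddle estimate. Outside [u, v] there are no
      tags, so any open set serves there.\<close>
    define G where "G t = (if t \<in> N then U else if t \<in> {u..v} then ball t (d t) else UNIV)" for t
    have "gauge G"
      unfolding gauge_def G_def using U d by (auto simp: good_def)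
    then obtain p where p: "p tagged_division_of {u..v}" "G fine p"
      using fine_division_exists_real by blast
    have tag: "\<exists>l r. K = {l..r} \<and> l \<le> r \<and> u \<le> l \<and> r \<le> v \<and> l \<le> x \<and> x \<le> r \<and> K \<subseteq> G x"
      if xK: "(x, K) \<in> p" for x K
    proof -
      obtain l r where "K = {l..r}"
        using tagged_division_ofD(4)[OF p(1) xK] by auto
      moreover have "x \<in> K" "K \<subseteq> {u..v}" "K \<subseteq> G x"
        using tagged_division_ofD(2,3)[OF p(1) that] p(2) that by (auto simp: fine_def)
      ultimately show ?thesis by auto
    qed
    \<comment> \<open>Endpoints are read off as \<open>Inf\<close> and \<open>Sup\<close>, the form
      in which \<open>additive_tagged_division_1\<close> telescopes.\<close>
    define l r where "l = (\<lambda>i :: real \<times> real set. Inf (snd i))" and "r = (\<lambda>i :: real \<times> real set. Sup (snd i))"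
    have lr: "snd i = {l i..r i} \<and> l i \<le> r i \<and> u \<le> l i \<and> r i \<le> v \<and> l i \<le> fst i \<and> fst i \<le> r i
        \<and> {l i..r i} \<subseteq> G (fst i)" if "i \<in> p" for i
      using tag[of "fst i" "snd i"] that unfolding l_def r_def by auto
    have fin: "finite p" using p(1) by auto
    have disj: "disjoint_family_on (\<lambda>i. {l i<..<r i}) p"
    proof -
      have "{l i<..<r i} \<inter> {l j<..<r j} = {}" if "i \<in> p" "j \<in> p" "i \<noteq> j" for i j
      proof -
        have "interior (snd i) \<inter> interior (snd j) = {}"
          using tagged_division_ofD(5)[OF p(1), of "fst i" "snd i" "fst j" "snd j"] that by auto
        then show ?thesis using lr that by simp
      qed
      then show ?thesis unfolding disjoint_family_on_def by blast
    qed
    define bad where "bad = {i \<in> p. fst i \<in> N}"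
    have bad: "(\<Sum>i\<in>bad. \<bar>f (r i) - f (l i)\<bar>) < \<epsilon>"
    proof (rule \<eta>(2)[rule_format])
      show "finite bad" "disjoint_family_on (\<lambda>i. {l i<..<r i}) bad"
        using fin disj by (auto simp: bad_def disjoint_family_on_def)
      have "ennreal (\<Sum>i\<in>bad. r i - l i) \<le> emeasure lebesgue U"
      proof (rule sum_length_disjoint_intervals_le)
        show "finite bad" "disjoint_family_on (\<lambda>i. {l i<..<r i}) bad" by fact+
        show "{l i<..<r i} \<subseteq> U" if "i \<in> bad" for i
          using lr[of i] that by (auto simp: bad_def G_def split: if_splits)
      qed (use U lr in \<open>auto simp: bad_def\<close>)
      then show "(\<Sum>i\<in>bad. r i - l i) < \<eta>"
        using U_small \<eta>(1) ennreal_less_iff[of "\<Sum>i\<in>bad. r i - l i" \<eta>] lr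
        by (fastforce intro: sum_nonneg simp: bad_def)
    qed (use lr in \<open>auto simp: bad_def\<close>)
    \<comment> \<open>The increment telescopes over the division. The good part costs at most
      \<open>\<epsilon> * (v - u)\<close>, the bad part less than \<epsilon>.\<close>
    have "f v - f u = (\<Sum>i\<in>p. f (r i) - f (l i))"
      using additive_tagged_division_1[OF \<open>u \<le> v\<close> p(1), of f] by (simp add: l_def r_def split_def)
    also have "\<dots> = (\<Sum>i\<in>p - bad. f (r i) - f (l i)) + (\<Sum>i\<in>bad. f (r i) - f (l i))"
      by (rule sum.subset_diff) (use fin in \<open>auto simp: bad_def\<close>)
    also have "(\<Sum>i\<in>bad. f (r i) - f (l i)) \<le> (\<Sum>i\<in>bad. \<bar>f (r i) - f (l i)\<bar>)"
      by (rule sum_mono) simp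
    also have "(\<Sum>i\<in>p - bad. f (r i) - f (l i)) \<le> (\<Sum>i\<in>p - bad. \<epsilon> * (r i - l i))"
    proof (rule sum_mono)
      fix i assume i: "i \<in> p - bad"
      then have mem: "fst i \<in> {u..v}" "fst i \<notin> N"
        using lr[of i] by (auto simp: bad_def)
      then have "{l i..r i} \<subseteq> ball (fst i) (d (fst i))"
        using lr[of i] i by (auto simp: G_def)
      moreover have "l i \<in> {l i..r i}" "r i \<in> {l i..r i}"
        using lr[of i] i by auto
      ultimately have "l i \<in> ball (fst i) (d (fst i))" "r i \<in> ball (fst i) (d (fst i))"
        by blast+
      then show "f (r i) - f (l i) \<le> \<epsilon> * (r i - l i)"
        using d[OF mem] lr[of i] i by (auto simp: good_def dist_real_def)
    qed
    also have "\<dots> \<le> (\<Sum>i\<in>p. \<epsilon> * (r i - l i))"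
      by (rule sum_mono2) (use fin lr \<open>\<epsilon> > 0\<close> in auto)
    also have "\<dots> = \<epsilon> * (v - u)"
      using additive_tagged_division_1[OF \<open>u \<le> v\<close> p(1), of "\<lambda>x. x"]
      by (simp add: l_def r_def split_def sum_distrib_left[symmetric])
    finally show ?thesis using bad by simp
  qed
  note bound = this
  show ?thesis
  proof (rule ccontr)
    assume "\<not> f v \<le> f u"
    then have pos: "f v - f u > 0" by simp
    \<comment> \<open>With this choice the bound is exactly half of the supposed positive
      increment.\<close>
    define \<epsilon> where "\<epsilon> = (f v - f u) / (2 * (v - u + 1))"
    have "\<epsilon> > 0" using pos \<open>u \<le> v\<close> by (simp add: \<epsilon>_def)
    moreover have "\<epsilon> * (v - u) + \<epsilon> = (f v - f u) / 2"
      using \<open>u \<le> v\<close> by (simp add: \<epsilon>_def divide_simps) (simp add: algebra_simps)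
    ultimately show False using bound[of \<epsilon>] pos by simp
  qed
qed

lemma abs_continuous_on_interval_subset:
  assumes "abs_continuous_on_interval f u v" "u \<le> u'" "v' \<le> v"
  shows "abs_continuous_on_interval f u' v'"
  unfolding abs_continuous_on_interval_def
proof (intro allI impI)
  fix \<epsilon> :: real assume "\<epsilon> > 0"
  then obtain \<eta> where "\<eta> > 0" and \<eta>: "\<forall>(n::nat) l r. (\<forall>i<n. u \<le> l i \<and> l i \<le> r i \<and> r i \<le> v) \<longrightarrow>
        disjoint_family_on (\<lambda>i. {l i<..<r i}) {..<n} \<longrightarrow> (\<Sum>i<n. r i - l i) < \<eta> \<longrightarrow>
        (\<Sum>i<n. \<bar>f (r i) - f (l i)\<bar>) < \<epsilon>"
    using assms(1) unfolding abs_continuous_on_interval_def by blast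
  show "\<exists>\<eta>>0. \<forall>(n::nat) l r. (\<forall>i<n. u' \<le> l i \<and> l i \<le> r i \<and> r i \<le> v') \<longrightarrow>
        disjoint_family_on (\<lambda>i. {l i<..<r i}) {..<n} \<longrightarrow> (\<Sum>i<n. r i - l i) < \<eta> \<longrightarrow>
        (\<Sum>i<n. \<bar>f (r i) - f (l i)\<bar>) < \<epsilon>"
    by (intro exI[of _ \<eta>] conjI \<open>\<eta> > 0\<close> allI impI, rule \<eta>[rule_format])
      (use assms(2,3) in \<open>auto intro: order_trans\<close>)
qed

lemma abs_continuous_on_interval_dominated:
  assumes f: "abs_continuous_on_interval f u v" and "K \<ge> 0" "C \<ge> 0"
    and le: "\<And>s t. u \<le> s \<Longrightarrow> s \<le> t \<Longrightarrow> t \<le> v \<Longrightarrow> \<bar>g t - g s\<bar> \<le> C * \<bar>f t - f s\<bar> + K * (t - s)"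
  shows "abs_continuous_on_interval g u v"
  unfolding abs_continuous_on_interval_def
proof (intro allI impI)
  fix \<epsilon> :: real assume "\<epsilon> > 0"
  \<comment> \<open>Each of the two dominating terms gets half of \<epsilon>; the added 1 here and
    in \<zeta> guards against a zero denominator.\<close>
  define \<epsilon>' where "\<epsilon>' = \<epsilon> / (2 * (C + 1))"
  have "\<epsilon>' > 0" using \<open>\<epsilon> > 0\<close> \<open>C \<ge> 0\<close> by (simp add: \<epsilon>'_def)
  then obtain \<eta> where "\<eta> > 0" and \<eta>: "\<forall>(n::nat) l r. (\<forall>i<n. u \<le> l i \<and> l i \<le> r i \<and> r i \<le> v) \<longrightarrow>
        disjoint_family_on (\<lambda>i. {l i<..<r i}) {..<n} \<longrightarrow> (\<Sum>i<n. r i - l i) < \<eta> \<longrightarrow>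
        (\<Sum>i<n. \<bar>f (r i) - f (l i)\<bar>) < \<epsilon>'"
    using f unfolding abs_continuous_on_interval_def by blast
  define \<zeta> where "\<zeta> = min \<eta> (\<epsilon> / (2 * (K + 1)))"
  show "\<exists>\<eta>>0. \<forall>(n::nat) l r. (\<forall>i<n. u \<le> l i \<and> l i \<le> r i \<and> r i \<le> v) \<longrightarrow>
        disjoint_family_on (\<lambda>i. {l i<..<r i}) {..<n} \<longrightarrow> (\<Sum>i<n. r i - l i) < \<eta> \<longrightarrow>
        (\<Sum>i<n. \<bar>g (r i) - g (l i)\<bar>) < \<epsilon>"
  proof (intro exI[of _ \<zeta>] conjI allI impI)
    show "\<zeta> > 0" using \<open>\<eta> > 0\<close> \<open>\<epsilon> > 0\<close> \<open>K \<ge> 0\<close> by (simp add: \<zeta>_def)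
    fix n :: nat and l r :: "nat \<Rightarrow> real"
    assume A: "\<forall>i<n. u \<le> l i \<and> l i \<le> r i \<and> r i \<le> v" "disjoint_family_on (\<lambda>i. {l i<..<r i}) {..<n}"
      and small: "(\<Sum>i<n. r i - l i) < \<zeta>"
    have F: "(\<Sum>i<n. \<bar>f (r i) - f (l i)\<bar>) < \<epsilon>'"
      using \<eta> A small by (simp add: \<zeta>_def)
    have "(\<Sum>i<n. \<bar>g (r i) - g (l i)\<bar>) \<le> (\<Sum>i<n. C * \<bar>f (r i) - f (l i)\<bar> + K * (r i - l i))"
      by (rule sum_mono) (use le A(1) in auto)
    also have "\<dots> = C * (\<Sum>i<n. \<bar>f (r i) - f (l i)\<bar>) + K * (\<Sum>i<n. r i - l i)"
      by (simp add: sum.distrib sum_distrib_left)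
    also have "\<dots> \<le> C * \<epsilon>' + K * (\<epsilon> / (2 * (K + 1)))"
      using F small \<open>K \<ge> 0\<close> \<open>C \<ge> 0\<close> by (intro add_mono mult_left_mono) (auto simp: \<zeta>_def)
    also have "\<dots> < \<epsilon> / 2 + \<epsilon> / 2"
    proof (rule add_strict_mono)
      show "C * \<epsilon>' < \<epsilon> / 2"
        using \<open>\<epsilon> > 0\<close> \<open>C \<ge> 0\<close> by (simp add: \<epsilon>'_def field_simps)
      show "K * (\<epsilon> / (2 * (K + 1))) < \<epsilon> / 2"
        using \<open>\<epsilon> > 0\<close> \<open>K \<ge> 0\<close> by (simp add: field_simps)
    qed
    finally show "(\<Sum>i<n. \<bar>g (r i) - g (l i)\<bar>) < \<epsilon>" by simp
  qed
qed

text \<open>A continuous derivative is bounded on the compact interval, so \<open>g\<close> is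
  Lipschitz there and the sum is dominated by increments of \<open>f\<close> and of the
  identity.\<close>

lemma abs_continuous_on_interval_add_smooth:
  assumes f: "abs_continuous_on_interval f u v"
    and deriv: "\<And>t. t \<in> {u..v} \<Longrightarrow> (g has_real_derivative g' t) (at t)" and g': "continuous_on {u..v} g'"
  shows "abs_continuous_on_interval (\<lambda>t. g t + c * f t) u v"
proof -
  have "bounded (g' ` {u..v})"
    using compact_continuous_image[OF g'] by (simp add: compact_imp_bounded)
  then obtain K where K: "\<And>t. t \<in> {u..v} \<Longrightarrow> \<bar>g' t\<bar> \<le> K" "K \<ge> 0"
    unfolding bounded_pos by (metis image_eqI less_imp_le real_norm_def)
  show ?thesis
  proof (rule abs_continuous_on_interval_dominated[OF f \<open>K \<ge> 0\<close>, of "\<bar>c\<bar>"])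
    fix s t assume st: "u \<le> s" "s \<le> t" "t \<le> v"
    have "\<bar>g t - g s\<bar> \<le> K * \<bar>t - s\<bar>"
    proof (rule field_differentiable_bound[of "{u..v}" g g' K t s, simplified])
      show "(g has_real_derivative g' z) (at z within {u..v})" if "u \<le> z \<and> z \<le> v" for z
        using deriv[of z] that by (auto intro: has_field_derivative_at_within)
      show "\<bar>g' z\<bar> \<le> K" if "u \<le> z \<and> z \<le> v" for z
        using K(1) that by auto
    qed (use st in auto)
    moreover have "\<bar>g t + c * f t - (g s + c * f s)\<bar> \<le> \<bar>g t - g s\<bar> + \<bar>c\<bar> * \<bar>f t - f s\<bar>"
    proof -
      have "g t + c * f t - (g s + c * f s) = (g t - g s) + c * (f t - f s)"
        by (simp add: algebra_simps)
      then show ?thesis by (metis abs_mult abs_triangle_ineq)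
    qed
    ultimately show "\<bar>g t + c * f t - (g s + c * f s)\<bar> \<le> \<bar>c\<bar> * \<bar>f t - f s\<bar> + K * (t - s)"
      using st by simp
  qed simp
qed

lemma abs_continuous_on_interval_imp_continuous_on:
  assumes "abs_continuous_on_interval f u v"
  shows "continuous_on {u..v} f"
  unfolding continuous_on_iff
proof (intro ballI allI impI)
  fix s \<epsilon> :: real assume s: "s \<in> {u..v}" and "\<epsilon> > 0"
  then obtain \<eta> where "\<eta> > 0" and \<eta>: "\<forall>(n::nat) l r. (\<forall>i<n. u \<le> l i \<and> l i \<le> r i \<and> r i \<le> v) \<longrightarrow>
        disjoint_family_on (\<lambda>i. {l i<..<r i}) {..<n} \<longrightarrow> (\<Sum>i<n. r i - l i) < \<eta> \<longrightarrow>
        (\<Sum>i<n. \<bar>f (r i) - f (l i)\<bar>) < \<epsilon>"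
    using assms unfolding abs_continuous_on_interval_def by blast
  have le: "\<bar>f q - f p\<bar> < \<epsilon>" if "u \<le> p" "p \<le> q" "q \<le> v" "q - p < \<eta>" for p q
    using \<eta>[rule_format, of 1 "\<lambda>_. p" "\<lambda>_. q"] that by (simp add: disjoint_family_on_def)
  show "\<exists>d>0. \<forall>t\<in>{u..v}. dist t s < d \<longrightarrow> dist (f t) (f s) < \<epsilon>"
  proof (intro exI[of _ \<eta>] conjI ballI impI \<open>\<eta> > 0\<close>)
    fix t assume t: "t \<in> {u..v}" "dist t s < \<eta>"
    show "dist (f t) (f s) < \<epsilon>"
      using le[of s t] le[of t s] s t by (cases "s \<le> t") (auto simp: dist_real_def abs_minus_commute)
  qed
qed

text \<open>Both \<open>f t - K * t\<close> and \<open>- f t - K * t\<close> have nonpositive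
  derivative a.e. and are therefore nonincreasing; the sign \<open>c\<close> treats them
  together.\<close>

lemma abs_continuous_increment_le:
  assumes ac: "abs_continuous_on_interval f u v" and "u \<le> v"
    and ae: "AE t in lebesgue. t \<in> {u..v} \<longrightarrow> f differentiable (at t) \<and> \<bar>deriv f t\<bar> \<le> K"
  shows "\<bar>f v - f u\<bar> \<le> K * (v - u)"
proof -
  have "c * f v - c * f u \<le> K * (v - u)" if c: "\<bar>c\<bar> = 1" for c
  proof -
    have "- K * v + c * f v \<le> - K * u + c * f u"
    proof (rule abs_continuous_nonpos_deriv_antimono[OF _ \<open>u \<le> v\<close>])
      show "abs_continuous_on_interval (\<lambda>t. - K * t + c * f t) u v"
        by (rule abs_continuous_on_interval_add_smooth[OF ac, where g' = "\<lambda>_. - K"])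
          (auto intro!: derivative_eq_intros)
      show "AE t in lebesgue. t \<in> {u..v} \<longrightarrow>
          (\<exists>D\<le>0. ((\<lambda>t. - K * t + c * f t) has_real_derivative D) (at t))"
        using ae
      proof (rule AE_mp, intro AE_I2 impI)
        fix t assume "t \<in> {u..v} \<longrightarrow> f differentiable (at t) \<and> \<bar>deriv f t\<bar> \<le> K" "t \<in> {u..v}"
        then have f': "(f has_real_derivative deriv f t) (at t)" "\<bar>deriv f t\<bar> \<le> K"
          by (auto simp: DERIV_deriv_iff_real_differentiable)
        have "c * deriv f t \<le> K"
          using f'(2) c by (metis abs_le_D1 abs_mult mult_1)
        then show "\<exists>D\<le>0. ((\<lambda>t. - K * t + c * f t) has_real_derivative D) (at t)"
          by (intro exI[of _ "- K + c * deriv f t"]) (auto intro!: derivative_eq_intros f'(1))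
      qed
    qed
    then show ?thesis by (simp add: algebra_simps)
  qed
  from this[of 1] this[of "-1"] show ?thesis by simp
qed

section \<open>Comparison principle for the retarded equation\<close>

text \<open>Since \<open>e B\<close> times the delay is \<open>1\<close>, the retarded value of \<open>p t = w t * exp (e B t)\<close> enters
  the equation for \<open>p\<close> with weight at most \<open>e B\<close>. After the last point \<open>s\<close> where \<open>p\<close> attains its
  running maximum, \<open>p s * exp (- e B t) - w t\<close> is therefore nonincreasing, so \<open>p\<close> never drops below
  its maximum.\<close>

lemma retarded_inequality_nonneg:
  fixes w b :: "real \<Rightarrow> real"
  assumes ac: "abs_continuous_on_interval w \<sigma> T" and "B > 0" and "w \<sigma> \<ge> 0"
    and ae: "AE t in lebesgue. t \<in> {\<sigma>..T} \<longrightarrow> 0 \<le> b t \<and> b t \<le> B \<and>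
               (\<exists>D\<ge>- b t * w (max (t - 1 / (B * exp 1)) \<sigma>). (w has_real_derivative D) (at t))"
    and t: "t \<in> {\<sigma>..T}"
  shows "w t \<ge> 0"
proof -
  define c where "c = B * exp 1"
  have "c > 0" using \<open>B > 0\<close> by (simp add: c_def)
  define p where "p s = w s * exp (c * s)" for s
  have "continuous_on {\<sigma>..t} p"
    unfolding p_def using t
    by (intro continuous_intros continuous_on_subset[OF abs_continuous_on_interval_imp_continuous_on[OF ac]]) auto
  then obtain s where s: "s \<in> {\<sigma>..t}" and max: "\<And>y. y \<in> {\<sigma>..t} \<Longrightarrow> p y \<le> p s"
    using continuous_attains_sup[of "{\<sigma>..t}" p] t by auto
  have "p \<sigma> \<ge> 0" using \<open>w \<sigma> \<ge> 0\<close> by (simp add: p_def)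
  then have "p s \<ge> 0" using max[of \<sigma>] t by auto
  \<comment> \<open>The right-hand side vanishes by the definition of \<open>p\<close>, so
    monotonicity on [s, t] yields \<open>w t \<ge> p s * exp (- c * t) \<ge> 0\<close>.\<close>
  have "p s * exp (- c * t) + (-1) * w t \<le> p s * exp (- c * s) + (-1) * w s"
  proof (rule abs_continuous_nonpos_deriv_antimono[where f = "\<lambda>y. p s * exp (- c * y) + (-1) * w y"])
    show "abs_continuous_on_interval (\<lambda>y. p s * exp (- c * y) + (-1) * w y) s t"
      by (rule abs_continuous_on_interval_add_smooth[OF abs_continuous_on_interval_subset[OF ac],
            where g' = "\<lambda>y. - c * p s * exp (- c * y)"])
        (use s t in \<open>auto intro!: derivative_eq_intros continuous_intros\<close>)
    show "s \<le> t" using s by simp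
    show "AE y in lebesgue. y \<in> {s..t} \<longrightarrow>
        (\<exists>D\<le>0. ((\<lambda>y. p s * exp (- c * y) + (-1) * w y) has_real_derivative D) (at y))"
      using ae
    proof (rule AE_mp, intro AE_I2 impI)
      fix y assume "y \<in> {\<sigma>..T} \<longrightarrow> 0 \<le> b y \<and> b y \<le> B \<and>
               (\<exists>D\<ge>- b y * w (max (y - 1 / (B * exp 1)) \<sigma>). (w has_real_derivative D) (at y))"
        and y: "y \<in> {s..t}"
      then obtain D where b: "0 \<le> b y" "b y \<le> B" and D: "(w has_real_derivative D) (at y)"
        and D_ge: "- b y * w (max (y - 1 / c) \<sigma>) \<le> D"
        using s t by (auto simp: c_def)
      define z where "z = max (y - 1 / c) \<sigma>"
      \<comment> \<open>Freezing the argument at \<sigma> keeps it in the interval over which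
        \<open>p s\<close> is the maximum.\<close>
      have z: "z \<in> {\<sigma>..t}" using y s \<open>c > 0\<close> by (auto simp: z_def intro: order_trans[of _ y])
      have "w z = p z * exp (- c * z)" by (simp add: p_def exp_minus)
      also have "\<dots> \<le> p s * exp (- c * z)" using max[OF z] by simp
      \<comment> \<open>A delay of at most \<open>1 / c\<close> costs at most a factor
        \<open>e\<close>, and this factor turns \<open>B\<close> into \<open>c\<close>.\<close>
      also have "\<dots> \<le> p s * exp (1 - c * y)"
      proof (rule mult_left_mono[OF _ \<open>p s \<ge> 0\<close>])
        have "c * (y - 1 / c) \<le> c * z"
          using \<open>c > 0\<close> by (intro mult_left_mono) (auto simp: z_def)
        then show "exp (- c * z) \<le> exp (1 - c * y)"
          using \<open>c > 0\<close> by (simp add: algebra_simps)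
      qed
      finally have w: "w z \<le> exp 1 * (p s * exp (- c * y))"
        by (simp add: exp_diff exp_minus field_simps)
      have "b y * w z \<le> b y * (exp 1 * (p s * exp (- c * y)))"
        using w b by (intro mult_left_mono)
      also have "\<dots> \<le> B * (exp 1 * (p s * exp (- c * y)))"
        using b \<open>p s \<ge> 0\<close> by (intro mult_right_mono) auto
      finally have "- c * p s * exp (- c * y) - D \<le> 0"
        using D_ge by (simp add: c_def z_def algebra_simps)
      then show "\<exists>D\<le>0. ((\<lambda>y. p s * exp (- c * y) + (-1) * w y) has_real_derivative D) (at y)"
        by (intro exI[of _ "- c * p s * exp (- c * y) - D"]) (auto intro!: derivative_eq_intros D)
    qed
  qed
  also have "\<dots> = 0" by (simp add: p_def exp_minus)
  finally show ?thesis
    using \<open>p s \<ge> 0\<close> by (smt (verit) exp_gt_zero mult_nonneg_nonneg)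
qed

text \<open>The functions \<open>C * exp (- \<gamma> * (t - \<sigma>)) + x t\<close> and
  \<open>C * exp (- \<gamma> * (t - \<sigma>)) - x t\<close> satisfy the preceding retarded
  inequality. The loss \<open>\<gamma> * C\<close> in the assumption pays for the derivative of the
  decaying barrier.\<close>

lemma retarded_perturbation_bound:
  fixes x b :: "real \<Rightarrow> real"
  assumes ac: "abs_continuous_on_interval x \<sigma> T" and "B > 0" and "\<gamma> \<ge> 0" and "\<bar>x \<sigma>\<bar> \<le> C"
    and ae: "AE t in lebesgue. t \<in> {\<sigma>..T} \<longrightarrow> 0 \<le> b t \<and> b t \<le> B \<and> x differentiable (at t) \<and>
        exp (\<gamma> * (t - \<sigma>)) * \<bar>deriv x t + b t * x (max (t - 1 / (B * exp 1)) \<sigma>)\<bar> \<le> (b t - \<gamma>) * C"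
    and t: "t \<in> {\<sigma>..T}"
  shows "exp (\<gamma> * (t - \<sigma>)) * \<bar>x t\<bar> \<le> C"
proof -
  have "C \<ge> 0" using assms(4) by linarith
  have nonneg: "C * exp (- \<gamma> * (t - \<sigma>)) + c * x t \<ge> 0" if c: "\<bar>c\<bar> = 1" for c
  proof (rule retarded_inequality_nonneg[where b = b, OF _ \<open>B > 0\<close> _ _ t])
    show "abs_continuous_on_interval (\<lambda>t. C * exp (- \<gamma> * (t - \<sigma>)) + c * x t) \<sigma> T"
      by (rule abs_continuous_on_interval_add_smooth[OF ac, where g' = "\<lambda>t. - \<gamma> * C * exp (- \<gamma> * (t - \<sigma>))"])
        (auto intro!: derivative_eq_intros continuous_intros)
    have "c * x \<sigma> \<ge> - \<bar>x \<sigma>\<bar>" using c by (metis abs_ge_minus_self abs_mult mult_1 neg_le_iff_le minus_le_iff)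
    then show "C * exp (- \<gamma> * (\<sigma> - \<sigma>)) + c * x \<sigma> \<ge> 0" using assms(4) by simp
    show "AE t in lebesgue. t \<in> {\<sigma>..T} \<longrightarrow> 0 \<le> b t \<and> b t \<le> B \<and>
       (\<exists>D\<ge>- b t * (C * exp (- \<gamma> * (max (t - 1 / (B * exp 1)) \<sigma> - \<sigma>))
              + c * x (max (t - 1 / (B * exp 1)) \<sigma>)).
           ((\<lambda>t. C * exp (- \<gamma> * (t - \<sigma>)) + c * x t) has_real_derivative D) (at t))"
      using ae
    proof (rule AE_mp, intro AE_I2 impI)
      fix t assume H: "t \<in> {\<sigma>..T} \<longrightarrow> 0 \<le> b t \<and> b t \<le> B \<and> x differentiable (at t) \<and>
        exp (\<gamma> * (t - \<sigma>)) * \<bar>deriv x t + b t * x (max (t - 1 / (B * exp 1)) \<sigma>)\<bar> \<le> (b t - \<gamma>) * C"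
        and t: "t \<in> {\<sigma>..T}"
      define z where "z = max (t - 1 / (B * exp 1)) \<sigma>"
      define E where "E = exp (- \<gamma> * (t - \<sigma>))"
      have "E > 0" by (simp add: E_def)
      have b: "0 \<le> b t" "b t \<le> B" and x': "(x has_real_derivative deriv x t) (at t)"
        and le: "exp (\<gamma> * (t - \<sigma>)) * \<bar>deriv x t + b t * x z\<bar> \<le> (b t - \<gamma>) * C"
        using H t by (auto simp: z_def DERIV_deriv_iff_real_differentiable)
      have "\<bar>deriv x t + b t * x z\<bar> \<le> E * ((b t - \<gamma>) * C)"
        using mult_left_mono[OF le, of E] \<open>E > 0\<close>
        by (simp add: E_def mult.assoc[symmetric] exp_add[symmetric])
      then have "c * (deriv x t + b t * x z) \<ge> - (E * ((b t - \<gamma>) * C))"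
        using c by (metis (no_types, opaque_lifting) abs_le_D2 abs_mult minus_le_iff mult_1)
      \<comment> \<open>The delayed barrier is at least the present one, because the barrier decays
        and \<open>z \<le> t\<close>.\<close>
      moreover have "b t * (C * E) \<le> b t * (C * exp (- \<gamma> * (z - \<sigma>)))"
      proof -
        have "z \<le> t" using t \<open>B > 0\<close> by (auto simp: z_def)
        then have "\<gamma> * (z - \<sigma>) \<le> \<gamma> * (t - \<sigma>)" using \<open>\<gamma> \<ge> 0\<close> by (intro mult_left_mono) auto
        then show ?thesis using b \<open>C \<ge> 0\<close> by (intro mult_left_mono) (auto simp: E_def)
      qed
      ultimately have "- b t * (C * exp (- \<gamma> * (z - \<sigma>)) + c * x z) \<le> - \<gamma> * C * E + c * deriv x t"
        by (simp add: algebra_simps)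
      moreover have "((\<lambda>t. C * exp (- \<gamma> * (t - \<sigma>)) + c * x t) has_real_derivative
          - \<gamma> * C * E + c * deriv x t) (at t)"
        by (auto intro!: derivative_eq_intros x' simp: E_def)
      ultimately show "0 \<le> b t \<and> b t \<le> B \<and>
       (\<exists>D\<ge>- b t * (C * exp (- \<gamma> * (max (t - 1 / (B * exp 1)) \<sigma> - \<sigma>))
              + c * x (max (t - 1 / (B * exp 1)) \<sigma>)).
           ((\<lambda>t. C * exp (- \<gamma> * (t - \<sigma>)) + c * x t) has_real_derivative D) (at t))"
        using b unfolding z_def by blast
    qed
  qed
  have "\<bar>x t\<bar> \<le> C * exp (- \<gamma> * (t - \<sigma>))"
    using nonneg[of 1] nonneg[of "-1"] by simp
  then have "exp (\<gamma> * (t - \<sigma>)) * \<bar>x t\<bar> \<le> exp (\<gamma> * (t - \<sigma>)) * (C * exp (- \<gamma> * (t - \<sigma>)))"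
    by (rule mult_left_mono) simp
  then show ?thesis by (simp add: mult.left_commute exp_add[symmetric])
qed

section \<open>Weighted estimates along a single solution\<close>

text \<open>The constants abstract from the norms: \<open>A\<close> and \<alpha> stand for those of
  \<open>a\<close> and \<open>a / bJ\<close>, \<open>\<beta> k\<close> and \<open>\<rho> k\<close>
  for those of \<open>b k\<close> and \<open>b k / bJ\<close>, and \<open>\<theta> k\<close> for
  that of \<open>t - h k t - r\<close>. \<open>L\<close> dominates every delay, including the
  artificial delay \<open>r\<close>. \<open>g_null\<close> is the null-preimage condition, phrased
  for a.e. properties.\<close>

locale neutral_coefficients =
  fixes t0 b0 B L A \<alpha> r :: real and m :: nat and J :: "nat set"
    and a g bJ :: "real \<Rightarrow> real" and b h :: "nat \<Rightarrow> real \<Rightarrow> real" and \<beta> \<rho> \<theta> :: "nat \<Rightarrow> real"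
  assumes J: "J \<subseteq> {1..m}"
    and b0: "0 < b0" and B: "0 < B" and r: "r = 1 / (B * exp 1)" "r \<le> L"
    and A: "0 \<le> A" and \<alpha>: "0 \<le> \<alpha>"
    and nonneg: "\<And>k. k \<in> {1..m} \<Longrightarrow> 0 \<le> \<beta> k \<and> 0 \<le> \<rho> k \<and> 0 \<le> \<theta> k"
    and bJ: "\<And>t. bJ t = (\<Sum>k\<in>J. b k t)" "\<And>t. t0 \<le> t \<Longrightarrow> b0 \<le> bJ t"
    and bJ_le: "AE t in lebesgue. t0 \<le> t \<longrightarrow> bJ t \<le> B"
    and a_le: "AE t in lebesgue. t0 \<le> t \<longrightarrow> \<bar>a t\<bar> \<le> A"
    and a_le_bJ: "AE t in lebesgue. t0 \<le> t \<longrightarrow> \<bar>a t\<bar> \<le> \<alpha> * bJ t"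
    and b_nonneg: "\<And>k t. k \<in> {1..m} \<Longrightarrow> t0 \<le> t \<Longrightarrow> 0 \<le> b k t"
    and b_le: "\<And>k. k \<in> {1..m} \<Longrightarrow> AE t in lebesgue. t0 \<le> t \<longrightarrow> b k t \<le> \<beta> k"
    and b_le_bJ: "\<And>k. k \<in> {1..m} \<Longrightarrow> AE t in lebesgue. t0 \<le> t \<longrightarrow> b k t \<le> \<rho> k * bJ t"
    and h: "\<And>k. k \<in> {1..m} \<Longrightarrow> AE t in lebesgue. t0 \<le> t \<longrightarrow> \<bar>t - h k t - r\<bar> \<le> \<theta> k"
    and h_delay: "\<And>k t. k \<in> {1..m} \<Longrightarrow> t0 \<le> t \<Longrightarrow> h k t \<in> {t - L..t}"
    and g_delay: "\<And>t. t0 \<le> t \<Longrightarrow> g t \<in> {t - L..t}"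
    and g_null: "\<And>P. AE s in lebesgue. P s \<Longrightarrow> AE t in lebesgue. t0 \<le> t \<longrightarrow> P (g t)"
begin

lemma r_pos: "0 < r"
  using B by (simp add: r)

lemma sum_split_J: "(\<Sum>k=1..m. f k) = (\<Sum>k\<in>J. f k) + (\<Sum>k\<in>{1..m} - J. f k)" for f :: "nat \<Rightarrow> real"
  using sum.subset_diff[OF J, of f] by simp

end

text \<open>\<open>D\<close> bounds the initial data, while \<open>Y\<close> and \<open>W\<close>
  are any weighted bounds of the solution and of its derivative on [\<sigma>, T]. \<open>q\<close>
  is the growth of the weight over one maximal delay.\<close>

locale neutral_trajectory = neutral_coefficients +
  fixes \<sigma> T \<gamma> D Y W q :: real and \<phi> \<psi> x :: "real \<Rightarrow> real"
  assumes sol: "neutral_solution m a g b h \<sigma> \<phi> \<psi> x"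
    and \<sigma>: "t0 \<le> \<sigma>" "\<sigma> \<le> T" and \<gamma>: "0 \<le> \<gamma>" and q: "q = exp (\<gamma> * L)"
    and \<phi>: "\<And>s. s \<le> \<sigma> \<Longrightarrow> \<bar>\<phi> s\<bar> \<le> D" and \<psi>: "\<And>s. s < \<sigma> \<Longrightarrow> \<bar>\<psi> s\<bar> \<le> D"
    and Y: "\<And>t. t \<in> {\<sigma>..T} \<Longrightarrow> exp (\<gamma> * (t - \<sigma>)) * \<bar>x t\<bar> \<le> Y"
    and W: "AE t in lebesgue. t \<in> {\<sigma>..T} \<longrightarrow> exp (\<gamma> * (t - \<sigma>)) * \<bar>deriv x t\<bar> \<le> W"
    and W_nonneg: "0 \<le> W"
begin

lemma x_initial: "s \<le> \<sigma> \<Longrightarrow> x s = \<phi> s"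
  using sol by (auto simp: neutral_solution_def)

lemma x_ac: "abs_continuous_on_interval x \<sigma> T"
  using sol \<sigma> by (auto simp: neutral_solution_def)

lemma x_differentiable: "AE t in lebesgue. t \<in> {\<sigma>..T} \<longrightarrow> x differentiable (at t)"
  using sol \<sigma> by (auto simp: neutral_solution_def AE_restrict_space_iff)

lemma x_equation: "AE t in lebesgue. t \<in> {\<sigma>..T} \<longrightarrow>
    deriv x t = a t * (if g t < \<sigma> then \<psi> (g t) else deriv x (g t)) - (\<Sum>k=1..m. b k t * x (h k t))"
  using sol unfolding neutral_solution_def
  by (auto simp: AE_restrict_space_iff elim!: AE_mp)

lemma D_nonneg: "0 \<le> D"
  using \<phi>[of \<sigma>] by linarith

lemma Y_nonneg: "0 \<le> Y"
  using Y[of \<sigma>] \<sigma> by simp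

lemma q_ge_1: "1 \<le> q"
  using r(2) r_pos \<gamma> unfolding q one_le_exp_iff by (intro mult_nonneg_nonneg) auto

lemma weight_le:
  assumes "s \<in> {t - L..t}"
  shows "exp (\<gamma> * (t - \<sigma>)) \<le> q * exp (\<gamma> * (s - \<sigma>))"
proof -
  have "\<gamma> * (t - \<sigma>) \<le> \<gamma> * (L + (s - \<sigma>))"
    using assms \<gamma> by (intro mult_left_mono) auto
  then show ?thesis by (simp add: q exp_add[symmetric] distrib_left)
qed

text \<open>If an argument within one delay of \<open>t\<close> reaches back to \<sigma>, then
  \<open>t \<le> \<sigma> + L\<close>; hence initial data enter only while the weight is at most
  \<open>q\<close>.\<close>

lemma weight_le_initial:
  assumes "s \<in> {t - L..t}" "s \<le> \<sigma>"
  shows "exp (\<gamma> * (t - \<sigma>)) \<le> q"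
proof -
  have "exp (\<gamma> * (s - \<sigma>)) \<le> 1"
    using assms \<gamma> by (simp add: mult_nonneg_nonpos)
  then have "q * exp (\<gamma> * (s - \<sigma>)) \<le> q"
    using q_ge_1 by (simp add: mult_left_le)
  with weight_le[OF assms(1)] show ?thesis by linarith
qed

lemma weighted_delayed_value:
  assumes "t \<in> {\<sigma>..T}" "s \<in> {t - L..t}"
  shows "exp (\<gamma> * (t - \<sigma>)) * \<bar>x s\<bar> \<le> q * (Y + D)"
proof (cases "s \<le> \<sigma>")
  case True
  have "exp (\<gamma> * (t - \<sigma>)) * \<bar>x s\<bar> \<le> q * D"
    using weight_le_initial[OF assms(2) True] \<phi>[OF True] q_ge_1 by (intro mult_mono) (auto simp: x_initial True)
  also have "\<dots> \<le> q * (Y + D)" using q_ge_1 Y_nonneg by simp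
  finally show ?thesis .
next
  case False
  have "exp (\<gamma> * (t - \<sigma>)) * \<bar>x s\<bar> \<le> q * exp (\<gamma> * (s - \<sigma>)) * \<bar>x s\<bar>"
    by (rule mult_right_mono[OF weight_le[OF assms(2)]]) simp
  also have "\<dots> \<le> q * Y"
    using Y[of s] False assms q_ge_1 by (simp add: mult.assoc)
  also have "\<dots> \<le> q * (Y + D)" using q_ge_1 D_nonneg by simp
  finally show ?thesis .
qed

text \<open>\<open>g_null\<close> carries the a.e. bound \<open>W\<close> over to the arguments
  \<open>g t\<close>; below \<sigma> the bound \<open>D\<close> of \<psi> takes its place.\<close>

lemma weighted_delayed_derivative:
  "AE t in lebesgue. t \<in> {\<sigma>..T} \<longrightarrow>
    exp (\<gamma> * (t - \<sigma>)) * \<bar>if g t < \<sigma> then \<psi> (g t) else deriv x (g t)\<bar> \<le> q * (W + D)"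
  using g_null[OF W]
proof (rule AE_mp, intro AE_I2 impI)
  fix t assume H: "t0 \<le> t \<longrightarrow> g t \<in> {\<sigma>..T} \<longrightarrow> exp (\<gamma> * (g t - \<sigma>)) * \<bar>deriv x (g t)\<bar> \<le> W"
    and t: "t \<in> {\<sigma>..T}"
  have g: "g t \<in> {t - L..t}" using g_delay t \<sigma> by simp
  show "exp (\<gamma> * (t - \<sigma>)) * \<bar>if g t < \<sigma> then \<psi> (g t) else deriv x (g t)\<bar> \<le> q * (W + D)"
  proof (cases "g t < \<sigma>")
    case True
    have "exp (\<gamma> * (t - \<sigma>)) * \<bar>\<psi> (g t)\<bar> \<le> q * D"
      using weight_le_initial[OF g] \<psi>[OF True] True q_ge_1 by (intro mult_mono) auto
    also have "\<dots> \<le> q * (W + D)" using q_ge_1 W_nonneg by simp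
    finally show ?thesis using True by simp
  next
    case False
    have "exp (\<gamma> * (t - \<sigma>)) * \<bar>deriv x (g t)\<bar> \<le> q * exp (\<gamma> * (g t - \<sigma>)) * \<bar>deriv x (g t)\<bar>"
      by (rule mult_right_mono[OF weight_le[OF g]]) simp
    also have "\<dots> \<le> q * W"
      using H False g t \<sigma> q_ge_1 by (simp add: mult.assoc)
    also have "\<dots> \<le> q * (W + D)" using q_ge_1 D_nonneg by simp
    finally show ?thesis using False by simp
  qed
qed

lemma weighted_increment:
  assumes t: "t \<in> {\<sigma>..T}" and uv: "u \<in> {t - L..t}" "v \<in> {t - L..t}"
  shows "exp (\<gamma> * (t - \<sigma>)) * \<bar>x (max v \<sigma>) - x (max u \<sigma>)\<bar> \<le> q * W * \<bar>v - u\<bar>"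
proof -
  have le: "exp (\<gamma> * (t - \<sigma>)) * \<bar>x v - x u\<bar> \<le> q * W * (v - u)"
    if uv: "\<sigma> \<le> u" "t - L \<le> u" "u \<le> v" "v \<le> t" for u v
  proof -
    \<comment> \<open>The weight is nondecreasing, so its value at the left end \<open>u\<close>
      gives the worst bound of the derivative on [u, v].\<close>
    define K where "K = W * exp (- \<gamma> * (u - \<sigma>))"
    have "\<bar>x v - x u\<bar> \<le> K * (v - u)"
    proof (rule abs_continuous_increment_le)
      show "abs_continuous_on_interval x u v"
        by (rule abs_continuous_on_interval_subset[OF x_ac]) (use uv t in auto)
      show "AE s in lebesgue. s \<in> {u..v} \<longrightarrow> x differentiable (at s) \<and> \<bar>deriv x s\<bar> \<le> K"
        using W x_differentiable
      proof eventually_elim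
        case (elim s)
        show ?case
        proof (intro impI conjI)
          assume s: "s \<in> {u..v}"
          then have s': "s \<in> {\<sigma>..T}" using uv t by auto
          then show "x differentiable (at s)" using elim by simp
          have "exp (\<gamma> * (u - \<sigma>)) * \<bar>deriv x s\<bar> \<le> exp (\<gamma> * (s - \<sigma>)) * \<bar>deriv x s\<bar>"
            using s \<gamma> by (intro mult_right_mono) (auto intro: mult_left_mono)
          also have "\<dots> \<le> W" using elim s' by simp
          finally have "exp (- \<gamma> * (u - \<sigma>)) * (exp (\<gamma> * (u - \<sigma>)) * \<bar>deriv x s\<bar>) \<le> exp (- \<gamma> * (u - \<sigma>)) * W"
            by (rule mult_left_mono) simp
          then show "\<bar>deriv x s\<bar> \<le> K"
            by (simp add: K_def mult.assoc[symmetric] exp_add[symmetric]) (simp add: mult.commute)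
        qed
      qed
    qed (use uv in simp)
    then have "exp (\<gamma> * (t - \<sigma>)) * \<bar>x v - x u\<bar> \<le> exp (\<gamma> * (t - \<sigma>)) * (K * (v - u))"
      by (rule mult_left_mono) simp
    also have "\<dots> \<le> (q * exp (\<gamma> * (u - \<sigma>))) * (K * (v - u))"
      using weight_le[of u t] uv W_nonneg by (intro mult_right_mono) (auto simp: K_def)
    also have "\<dots> = q * W * (v - u)"
    proof -
      have "exp (\<gamma> * (u - \<sigma>)) * exp (- \<gamma> * (u - \<sigma>)) = 1"
        by (simp add: exp_add[symmetric])
      then show ?thesis by (simp add: K_def mult.left_commute)
    qed
    finally show ?thesis .
  qed
  define u' v' where "u' = max u \<sigma>" and "v' = max v \<sigma>"
  have m: "\<sigma> \<le> u'" "t - L \<le> u'" "u' \<le> t" "\<sigma> \<le> v'" "t - L \<le> v'" "v' \<le> t"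
    using t uv by (auto simp: u'_def v'_def)
  have "exp (\<gamma> * (t - \<sigma>)) * \<bar>x v' - x u'\<bar> \<le> q * W * \<bar>v' - u'\<bar>"
    using le[of u' v'] le[of v' u'] m by (cases "u' \<le> v'") (auto simp: abs_minus_commute)
  \<comment> \<open>Clamping at \<sigma> does not increase distances.\<close>
  also have "\<dots> \<le> q * W * \<bar>v - u\<bar>"
    using q_ge_1 W_nonneg by (intro mult_left_mono) (auto simp: u'_def v'_def max_def)
  finally show ?thesis by (simp add: u'_def v'_def)
qed

text \<open>The defect is nonzero only when \<open>s\<close> lies before \<sigma>; then both values
  belong to \<phi> and the weight is at most \<open>q\<close>.\<close>

lemma weighted_frozen_defect:
  assumes "t \<in> {\<sigma>..T}" "s \<in> {t - L..t}"
  shows "exp (\<gamma> * (t - \<sigma>)) * \<bar>x (max s \<sigma>) - x s\<bar> \<le> 2 * q * D"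
proof (cases "s \<le> \<sigma>")
  case True
  have "\<bar>x (max s \<sigma>) - x s\<bar> \<le> 2 * D"
    using \<phi>[of s] \<phi>[of \<sigma>] True by (simp add: x_initial max_absorb2)
  then have "exp (\<gamma> * (t - \<sigma>)) * \<bar>x (max s \<sigma>) - x s\<bar> \<le> q * (2 * D)"
    using weight_le_initial[OF assms(2) True] q_ge_1 by (intro mult_mono) auto
  then show ?thesis by simp
next
  case False
  then show ?thesis using q_ge_1 D_nonneg by simp
qed

lemma coefficients_AE:
  "AE t in lebesgue. t \<in> {\<sigma>..T} \<longrightarrow> bJ t \<le> B \<and> \<bar>a t\<bar> \<le> A \<and> \<bar>a t\<bar> \<le> \<alpha> * bJ t \<and>
     (\<forall>k\<in>{1..m}. b k t \<le> \<beta> k \<and> b k t \<le> \<rho> k * bJ t \<and> \<bar>t - h k t - r\<bar> \<le> \<theta> k)"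
proof -
  have "AE t in lebesgue. \<forall>k\<in>{1..m}. t0 \<le> t \<longrightarrow> b k t \<le> \<beta> k \<and> b k t \<le> \<rho> k * bJ t \<and> \<bar>t - h k t - r\<bar> \<le> \<theta> k"
  proof (rule AE_finite_allI)
    fix k assume "k \<in> {1..m}"
    from b_le[OF this] b_le_bJ[OF this] h[OF this]
    show "AE t in lebesgue. t0 \<le> t \<longrightarrow> b k t \<le> \<beta> k \<and> b k t \<le> \<rho> k * bJ t \<and> \<bar>t - h k t - r\<bar> \<le> \<theta> k"
      by eventually_elim auto
  qed simp
  then show ?thesis
    using bJ_le a_le a_le_bJ by eventually_elim (use \<sigma> in auto)
qed

text \<open>Triangle inequality in the equation. \<open>W\<close> recurs on the right with factor
  \<open>A * q\<close>, to be absorbed once \<gamma> makes this factor less than 1.\<close>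

lemma weighted_derivative_bound:
  "AE t in lebesgue. t \<in> {\<sigma>..T} \<longrightarrow>
    exp (\<gamma> * (t - \<sigma>)) * \<bar>deriv x t\<bar> \<le> A * q * (W + D) + (\<Sum>k=1..m. \<beta> k) * q * (Y + D)"
  using x_equation weighted_delayed_derivative coefficients_AE
proof eventually_elim
  case (elim t)
  show ?case
  proof
    assume t: "t \<in> {\<sigma>..T}"
    define E where "E = exp (\<gamma> * (t - \<sigma>))"
    define y where "y = (if g t < \<sigma> then \<psi> (g t) else deriv x (g t))"
    have "E > 0" by (simp add: E_def)
    have y: "E * \<bar>y\<bar> \<le> q * (W + D)" and x': "deriv x t = a t * y - (\<Sum>k=1..m. b k t * x (h k t))"
      using elim t by (auto simp: E_def y_def)
    have "E * \<bar>deriv x t\<bar> \<le> E * (\<bar>a t\<bar> * \<bar>y\<bar> + (\<Sum>k=1..m. b k t * \<bar>x (h k t)\<bar>))"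
    proof (rule mult_left_mono)
      have "\<bar>deriv x t\<bar> \<le> \<bar>a t * y\<bar> + \<bar>\<Sum>k=1..m. b k t * x (h k t)\<bar>"
        unfolding x' by (rule abs_triangle_ineq4)
      also have "\<bar>\<Sum>k=1..m. b k t * x (h k t)\<bar> \<le> (\<Sum>k=1..m. \<bar>b k t * x (h k t)\<bar>)"
        by (rule sum_abs)
      also have "\<dots> = (\<Sum>k=1..m. b k t * \<bar>x (h k t)\<bar>)"
        using b_nonneg t \<sigma> by (intro sum.cong) (auto simp: abs_mult)
      finally show "\<bar>deriv x t\<bar> \<le> \<bar>a t\<bar> * \<bar>y\<bar> + (\<Sum>k=1..m. b k t * \<bar>x (h k t)\<bar>)"
        by (simp add: abs_mult)
    qed (use \<open>E > 0\<close> in simp)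
    also have "\<dots> = \<bar>a t\<bar> * (E * \<bar>y\<bar>) + (\<Sum>k=1..m. b k t * (E * \<bar>x (h k t)\<bar>))"
      by (simp add: distrib_left sum_distrib_left mult.left_commute)
    also have "\<dots> \<le> A * (q * (W + D)) + (\<Sum>k=1..m. \<beta> k * (q * (Y + D)))"
    proof (intro add_mono sum_mono)
      show "\<bar>a t\<bar> * (E * \<bar>y\<bar>) \<le> A * (q * (W + D))"
        using y elim t A \<open>E > 0\<close> by (intro mult_mono[of "\<bar>a t\<bar>" A]) auto
      fix k assume k: "k \<in> {1..m}"
      have "E * \<bar>x (h k t)\<bar> \<le> q * (Y + D)"
        unfolding E_def by (rule weighted_delayed_value[OF t h_delay[OF k]]) (use t \<sigma> in auto)
      then show "b k t * (E * \<bar>x (h k t)\<bar>) \<le> \<beta> k * (q * (Y + D))"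
        using elim t k nonneg \<open>E > 0\<close> by (intro mult_mono[of "b k t" "\<beta> k"]) auto
    qed
    finally show "exp (\<gamma> * (t - \<sigma>)) * \<bar>deriv x t\<bar> \<le> A * q * (W + D) + (\<Sum>k=1..m. \<beta> k) * q * (Y + D)"
      by (simp add: E_def sum_distrib_right mult.assoc)
  qed
qed

text \<open>Bound of the weighted perturbation relative to \<open>bJ t\<close>. The summands come
  from the neutral term, from replacing \<open>h k t\<close> by \<open>t - r\<close> for
  \<open>k\<close> in \<open>J\<close>, and from the remaining delayed terms.\<close>

definition forcing :: real where
  "forcing = \<alpha> * (q * (W + D)) + (\<Sum>k\<in>J. \<rho> k * (q * W * \<theta> k + 2 * q * D))
     + (\<Sum>k\<in>{1..m} - J. \<rho> k * (q * (Y + D)))"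

text \<open>Coefficients are compared with \<open>bJ t\<close> through \<alpha> and \<rho> instead
  of through \<open>A\<close> and \<beta>, so that \<open>bJ t\<close> factors out as the comparison
  principle requires.\<close>

lemma weighted_forcing_bound:
  "AE t in lebesgue. t \<in> {\<sigma>..T} \<longrightarrow>
    exp (\<gamma> * (t - \<sigma>)) * \<bar>deriv x t + bJ t * x (max (t - r) \<sigma>)\<bar> \<le> bJ t * forcing"
  using x_equation weighted_delayed_derivative coefficients_AE
proof eventually_elim
  case (elim t)
  show ?case
  proof
    assume t: "t \<in> {\<sigma>..T}"
    define E where "E = exp (\<gamma> * (t - \<sigma>))"
    define y where "y = (if g t < \<sigma> then \<psi> (g t) else deriv x (g t))"
    define z where "z = x (max (t - r) \<sigma>)"
    have "E > 0" by (simp add: E_def)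
    have bJ_pos: "bJ t > 0" using bJ(2)[of t] b0 t \<sigma> by simp
    have y: "E * \<bar>y\<bar> \<le> q * (W + D)" and x': "deriv x t = a t * y - (\<Sum>k=1..m. b k t * x (h k t))"
      using elim t by (auto simp: E_def y_def)
    have b: "0 \<le> b k t" "b k t \<le> \<rho> k * bJ t" "\<bar>t - h k t - r\<bar> \<le> \<theta> k" "h k t \<in> {t - L..t}"
      "0 \<le> \<rho> k" "0 \<le> \<theta> k" if "k \<in> {1..m}" for k
      using elim t b_nonneg[OF that] h_delay[OF that] nonneg[OF that] \<sigma> that by auto
    have split: "deriv x t + bJ t * z
        = a t * y + (\<Sum>k\<in>J. b k t * (z - x (h k t))) - (\<Sum>k\<in>{1..m} - J. b k t * x (h k t))"
      unfolding x' sum_split_J bJ(1) by (simp add: sum_distrib_right right_diff_distrib sum_subtractf)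
    have "E * \<bar>deriv x t + bJ t * z\<bar> \<le> E * (\<bar>a t\<bar> * \<bar>y\<bar> + (\<Sum>k\<in>J. b k t * \<bar>z - x (h k t)\<bar>)
        + (\<Sum>k\<in>{1..m} - J. b k t * \<bar>x (h k t)\<bar>))"
    proof (rule mult_left_mono)
      have "\<bar>\<Sum>k\<in>J. b k t * (z - x (h k t))\<bar> \<le> (\<Sum>k\<in>J. \<bar>b k t * (z - x (h k t))\<bar>)"
        by (rule sum_abs)
      also have "\<dots> = (\<Sum>k\<in>J. b k t * \<bar>z - x (h k t)\<bar>)"
        using b(1) J by (intro sum.cong) (auto simp: abs_mult)
      finally have 1: "\<bar>\<Sum>k\<in>J. b k t * (z - x (h k t))\<bar> \<le> (\<Sum>k\<in>J. b k t * \<bar>z - x (h k t)\<bar>)" .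
      have "\<bar>\<Sum>k\<in>{1..m} - J. b k t * x (h k t)\<bar> \<le> (\<Sum>k\<in>{1..m} - J. \<bar>b k t * x (h k t)\<bar>)"
        by (rule sum_abs)
      also have "\<dots> = (\<Sum>k\<in>{1..m} - J. b k t * \<bar>x (h k t)\<bar>)"
        using b(1) by (intro sum.cong) (auto simp: abs_mult)
      finally show "\<bar>deriv x t + bJ t * z\<bar> \<le> \<bar>a t\<bar> * \<bar>y\<bar> + (\<Sum>k\<in>J. b k t * \<bar>z - x (h k t)\<bar>)
        + (\<Sum>k\<in>{1..m} - J. b k t * \<bar>x (h k t)\<bar>)"
        using 1 unfolding split abs_mult[symmetric] by linarith
    qed (use \<open>E > 0\<close> in simp)
    also have "\<dots> = \<bar>a t\<bar> * (E * \<bar>y\<bar>) + (\<Sum>k\<in>J. b k t * (E * \<bar>z - x (h k t)\<bar>))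
        + (\<Sum>k\<in>{1..m} - J. b k t * (E * \<bar>x (h k t)\<bar>))"
      by (simp add: distrib_left sum_distrib_left mult.left_commute)
    also have "\<dots> \<le> (\<alpha> * bJ t) * (q * (W + D)) + (\<Sum>k\<in>J. (\<rho> k * bJ t) * (q * W * \<theta> k + 2 * q * D))
        + (\<Sum>k\<in>{1..m} - J. (\<rho> k * bJ t) * (q * (Y + D)))"
    proof (intro add_mono sum_mono)
      show "\<bar>a t\<bar> * (E * \<bar>y\<bar>) \<le> \<alpha> * bJ t * (q * (W + D))"
        using y elim t \<alpha> bJ_pos \<open>E > 0\<close> by (intro mult_mono[of "\<bar>a t\<bar>"]) auto
    next
      fix k assume "k \<in> J"
      then have k: "k \<in> {1..m}" using J by auto
      have "E * \<bar>z - x (h k t)\<bar> \<le> E * \<bar>z - x (max (h k t) \<sigma>)\<bar> + E * \<bar>x (max (h k t) \<sigma>) - x (h k t)\<bar>"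
        using \<open>E > 0\<close> unfolding distrib_left[symmetric] by (intro mult_left_mono) auto
      also have "\<dots> \<le> q * W * \<bar>t - r - h k t\<bar> + 2 * q * D"
        unfolding E_def z_def
        by (intro add_mono weighted_increment weighted_frozen_defect t b k) (use r r_pos in auto)
      also have "\<dots> \<le> q * W * \<theta> k + 2 * q * D"
        using b(3)[OF k] q_ge_1 W_nonneg by (intro add_mono mult_left_mono) auto
      finally show "b k t * (E * \<bar>z - x (h k t)\<bar>) \<le> \<rho> k * bJ t * (q * W * \<theta> k + 2 * q * D)"
        using b[OF k] bJ_pos \<open>E > 0\<close> by (intro mult_mono[of "b k t"]) auto
    next
      fix k assume "k \<in> {1..m} - J"
      then have k: "k \<in> {1..m}" by auto
      have "E * \<bar>x (h k t)\<bar> \<le> q * (Y + D)"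
        unfolding E_def by (rule weighted_delayed_value[OF t b(4)[OF k]])
      then show "b k t * (E * \<bar>x (h k t)\<bar>) \<le> \<rho> k * bJ t * (q * (Y + D))"
        using b[OF k] bJ_pos \<open>E > 0\<close> by (intro mult_mono[of "b k t"]) auto
    qed
    also have "\<dots> = bJ t * forcing"
      by (simp add: forcing_def distrib_left sum_distrib_left mult.assoc mult.left_commute)
    finally show "exp (\<gamma> * (t - \<sigma>)) * \<bar>deriv x t + bJ t * x (max (t - r) \<sigma>)\<bar> \<le> bJ t * forcing"
      by (simp add: E_def z_def)
  qed
qed

lemma forcing_nonneg: "0 \<le> forcing"
  unfolding forcing_def using \<alpha> q_ge_1 W_nonneg D_nonneg Y_nonneg nonneg J
  by (intro add_nonneg_nonneg sum_nonneg mult_nonneg_nonneg) auto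

text \<open>The comparison principle demands \<open>(bJ t - \<gamma>) * C\<close>. Since
  \<open>bJ t \<ge> b0\<close>, this is at least \<open>bJ t * (1 - \<gamma> / b0) * C\<close>,
  which explains the factor on the left. Adding \<open>D\<close> lets the constant \<open>C\<close>
  dominate \<open>\<bar>x \<sigma>\<bar>\<close> as well.\<close>

lemma weighted_value_bound:
  assumes "\<gamma> < b0" and t: "t \<in> {\<sigma>..T}"
  shows "(1 - \<gamma> / b0) * (exp (\<gamma> * (t - \<sigma>)) * \<bar>x t\<bar>) \<le> forcing + D"
proof -
  define \<kappa> where "\<kappa> = 1 - \<gamma> / b0"
  have \<kappa>: "\<kappa> > 0" "\<kappa> \<le> 1" using assms \<gamma> b0 by (auto simp: \<kappa>_def)
  define C where "C = (forcing + D) / \<kappa>"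
  have "D \<le> C"
  proof -
    have "D * \<kappa> \<le> forcing + D"
      using mult_left_mono[OF \<kappa>(2) D_nonneg] forcing_nonneg by simp
    then show ?thesis using \<kappa> by (simp add: C_def field_simps)
  qed
  have "exp (\<gamma> * (t - \<sigma>)) * \<bar>x t\<bar> \<le> C"
  proof (rule retarded_perturbation_bound[OF x_ac B \<gamma> _ _ t])
    show "\<bar>x \<sigma>\<bar> \<le> C" using \<phi>[of \<sigma>] \<open>D \<le> C\<close> by (simp add: x_initial)
    show "AE t in lebesgue. t \<in> {\<sigma>..T} \<longrightarrow> 0 \<le> bJ t \<and> bJ t \<le> B \<and> x differentiable (at t) \<and>
        exp (\<gamma> * (t - \<sigma>)) * \<bar>deriv x t + bJ t * x (max (t - 1 / (B * exp 1)) \<sigma>)\<bar> \<le> (bJ t - \<gamma>) * C"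
      using weighted_forcing_bound x_differentiable coefficients_AE
    proof eventually_elim
      case (elim t)
      show ?case
      proof
        assume t: "t \<in> {\<sigma>..T}"
        have b0_le: "b0 \<le> bJ t" using bJ(2) t \<sigma> by simp
        have "bJ t * forcing \<le> bJ t * (\<kappa> * C)"
          using b0_le b0 D_nonneg \<kappa> by (intro mult_left_mono) (auto simp: C_def)
        also have "bJ t * (\<kappa> * C) = (bJ t - bJ t / b0 * \<gamma>) * C"
          using b0 by (simp add: \<kappa>_def field_simps)
        also have "\<dots> \<le> (bJ t - \<gamma>) * C"
        proof (rule mult_right_mono)
          have "1 * \<gamma> \<le> bJ t / b0 * \<gamma>"
            using b0_le b0 \<gamma> by (intro mult_right_mono) auto
          then show "bJ t - bJ t / b0 * \<gamma> \<le> bJ t - \<gamma>" by simp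
          show "0 \<le> C" using \<open>D \<le> C\<close> D_nonneg by simp
        qed
        finally show "0 \<le> bJ t \<and> bJ t \<le> B \<and> x differentiable (at t) \<and>
            exp (\<gamma> * (t - \<sigma>)) * \<bar>deriv x t + bJ t * x (max (t - 1 / (B * exp 1)) \<sigma>)\<bar> \<le> (bJ t - \<gamma>) * C"
          using elim t b0 b0_le by (auto simp: r(1))
      qed
    qed
  qed
  then show ?thesis using \<kappa> by (simp add: C_def \<kappa>_def[symmetric] field_simps)
qed

end

section \<open>Least almost-everywhere bounds and the essential norm\<close>

text \<open>The infimum of all a.e. bounds is itself one, since countably many bounds approaching it
  hold simultaneously a.e.\<close>

lemma least_AE_bound:
  fixes f :: "'a \<Rightarrow> real"
  assumes "AE t in M. f t \<le> K" "0 \<le> K"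
  obtains W where "0 \<le> W" "AE t in M. f t \<le> W"
    "\<And>K. 0 \<le> K \<Longrightarrow> AE t in M. f t \<le> K \<Longrightarrow> W \<le> K"
proof -
  define S where "S = {K. 0 \<le> K \<and> (AE t in M. f t \<le> K)}"
  have S: "K \<in> S" "bdd_below S"
    using assms by (auto simp: S_def intro: bdd_belowI[of _ 0])
  have "AE t in M. f t \<le> Inf S + 1 / real (Suc n)" for n
  proof -
    obtain K where "K \<in> S" "K < Inf S + 1 / real (Suc n)"
      using cInf_lessD[of S "Inf S + 1 / real (Suc n)"] S(1) by force
    then have "AE t in M. f t \<le> K" by (simp add: S_def)
    then show ?thesis by eventually_elim (use \<open>K < _\<close> in linarith)
  qed
  then have "AE t in M. \<forall>n. f t \<le> Inf S + 1 / real (Suc n)"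
    by (simp add: AE_all_countable)
  then have "AE t in M. f t \<le> Inf S"
  proof (rule AE_mp, intro AE_I2 impI)
    fix t assume le: "\<forall>n. f t \<le> Inf S + 1 / real (Suc n)"
    show "f t \<le> Inf S"
    proof (rule field_le_epsilon)
      fix e :: real assume "e > 0"
      then obtain n where "1 / real (Suc n) < e" using nat_approx_posE by blast
      then show "f t \<le> Inf S + e" using le[rule_format, of n] by linarith
    qed
  qed
  moreover have "0 \<le> Inf S" using S by (intro cInf_greatest) (auto simp: S_def)
  moreover have "Inf S \<le> K" if "0 \<le> K" "AE t in M. f t \<le> K" for K
    using that S by (intro cInf_lower) (auto simp: S_def)
  ultimately show ?thesis using that by blast
qed

text \<open>A half-line contains a unit interval and is therefore not null.\<close>

lemma AE_lebesgue_atLeast_imp_ex: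
  assumes "AE t in lebesgue. c \<le> t \<longrightarrow> P t"
  shows "\<exists>t\<ge>c::real. P t"
proof (rule ccontr)
  assume "\<not> (\<exists>t\<ge>c. P t)"
  then have none: "\<not> P t" if "c \<le> t" for t
    using that by blast
  have "AE t in lebesgue. t \<notin> {c..c + 1}"
    using assms by eventually_elim (use none in auto)
  then have "{c..c + 1} \<in> null_sets lebesgue"
    using AE_iff_null_sets[of "{c..c + 1}" lebesgue] by simp
  then show False by (simp add: null_sets_def)
qed

lemma ess_bounded_on_subset:
  assumes "ess_bounded_on S f" "T \<subseteq> S" "S \<in> sets lebesgue" "T \<in> sets lebesgue"
  shows "ess_bounded_on T f"
proof -
  obtain K where "AE t in lebesgue. t \<in> S \<longrightarrow> \<bar>f t\<bar> \<le> K"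
    using assms(1,3) unfolding ess_bounded_on_def by (fastforce simp: AE_restrict_space_iff)
  then have "AE t in lebesgue. t \<in> T \<longrightarrow> \<bar>f t\<bar> \<le> K"
    by eventually_elim (use assms(2) in auto)
  moreover have "f \<in> borel_measurable (lebesgue_on T)"
    using assms(1,2) measurable_restrict_mono unfolding ess_bounded_on_def by blast
  ultimately show ?thesis
    unfolding ess_bounded_on_def using assms(4) by (intro conjI exI[of _ K]) (simp_all add: AE_restrict_space_iff)
qed

text \<open>The essential supremum is finite: an essential bound lies above it, and some value
  \<open>\<bar>f t\<bar>\<close> lies below it. Hence \<open>real_of_ereal\<close> does not fall
  back to its default 0.\<close>

lemma AE_le_ess_norm:
  assumes "ess_bounded_on {t0..} f"
  shows "AE t in lebesgue. t0 \<le> t \<longrightarrow> \<bar>f t\<bar> \<le> ess_norm t0 f"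
proof -
  let ?M = "lebesgue_on {t0..}" and ?s = "esssup (lebesgue_on {t0..}) (\<lambda>t. ereal \<bar>f t\<bar>)"
  obtain K where K: "AE t in ?M. \<bar>f t\<bar> \<le> K" and meas: "f \<in> borel_measurable ?M"
    using assms by (auto simp: ess_bounded_on_def)
  have "?s \<le> ereal K"
    using K meas by (intro esssup_I) auto
  have AE: "AE t in ?M. ereal \<bar>f t\<bar> \<le> ?s" by (rule esssup_AE)
  then obtain t where "ereal \<bar>f t\<bar> \<le> ?s"
    using AE_lebesgue_atLeast_imp_ex[of t0 "\<lambda>t. ereal \<bar>f t\<bar> \<le> ?s"] by (auto simp: AE_restrict_space_iff)
  with \<open>?s \<le> ereal K\<close> have "\<bar>?s\<bar> \<noteq> \<infinity>" by (cases ?s) auto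
  then have "?s = ereal (ess_norm t0 f)"
    by (auto simp: ess_norm_def ereal_real)
  with AE show ?thesis by (simp add: AE_restrict_space_iff)
qed

lemma ess_norm_nonneg:
  assumes "ess_bounded_on {t0..} f"
  shows "0 \<le> ess_norm t0 f"
  using AE_lebesgue_atLeast_imp_ex[OF AE_le_ess_norm[OF assms]] by force

section \<open>Choice of the decay rate and the closing contraction\<close>

context neutral_coefficients
begin

text \<open>At \<gamma> = 0 the strict inequalities reduce to the assumptions and to
  \<open>0 < b0\<close>; by continuity they persist for small positive \<gamma>.\<close>

lemma exists_decay_rate:
  assumes "A < 1"
    and "(\<alpha> + (\<Sum>k\<in>J. \<rho> k * \<theta> k)) * ((\<Sum>k=1..m. \<beta> k) / (1 - A)) + (\<Sum>k\<in>{1..m} - J. \<rho> k) < 1"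
  obtains \<gamma> where "0 < \<gamma>" "\<gamma> < b0" "A * exp (\<gamma> * L) < 1"
    "\<gamma> / b0 + (\<alpha> + (\<Sum>k\<in>J. \<rho> k * \<theta> k)) * exp (\<gamma> * L) * ((\<Sum>k=1..m. \<beta> k) * exp (\<gamma> * L) / (1 - A * exp (\<gamma> * L)))
       + (\<Sum>k\<in>{1..m} - J. \<rho> k) * exp (\<gamma> * L) < 1"
proof -
  define P S Q where "P = \<alpha> + (\<Sum>k\<in>J. \<rho> k * \<theta> k)" and "S = (\<Sum>k=1..m. \<beta> k)"
    and "Q = (\<Sum>k\<in>{1..m} - J. \<rho> k)"
  define F where "F \<gamma> = \<gamma> / b0 + P * exp (\<gamma> * L) * (S * exp (\<gamma> * L) / (1 - A * exp (\<gamma> * L)))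
    + Q * exp (\<gamma> * L)" for \<gamma>
  have "isCont (\<lambda>\<gamma>. exp (\<gamma> * L)) 0"
    by (intro continuous_intros)
  then have E: "((\<lambda>\<gamma>. exp (\<gamma> * L)) \<longlongrightarrow> 1) (at_right 0)"
    unfolding isCont_def by (auto intro: tendsto_within_subset)
  have "(F \<longlongrightarrow> 0 / b0 + P * 1 * (S * 1 / (1 - A * 1)) + Q * 1) (at_right 0)"
    unfolding F_def
    by (intro tendsto_add tendsto_divide tendsto_mult tendsto_diff tendsto_const tendsto_ident_at E)
      (use \<open>A < 1\<close> b0 in simp_all)
  then have "\<forall>\<^sub>F \<gamma> in at_right 0. F \<gamma> < 1"
    by (rule order_tendstoD(2)) (use assms(2) in \<open>simp add: P_def S_def Q_def\<close>)
  moreover have "\<forall>\<^sub>F \<gamma> in at_right 0. A * exp (\<gamma> * L) < 1"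
    by (rule order_tendstoD(2)[OF tendsto_mult[OF tendsto_const E]]) (use \<open>A < 1\<close> in simp)
  moreover have "\<forall>\<^sub>F \<gamma> in at_right 0. \<gamma> < b0"
    by (rule order_tendstoD(2)[OF tendsto_ident_at b0])
  moreover have "\<forall>\<^sub>F \<gamma> in at_right (0::real). 0 < \<gamma>"
    by (simp add: eventually_at_right_less)
  ultimately have "\<forall>\<^sub>F \<gamma> in at_right 0. 0 < \<gamma> \<and> \<gamma> < b0 \<and> A * exp (\<gamma> * L) < 1 \<and> F \<gamma> < 1"
    by eventually_elim auto
  then obtain \<gamma> where "0 < \<gamma> \<and> \<gamma> < b0 \<and> A * exp (\<gamma> * L) < 1 \<and> F \<gamma> < 1"
    using eventually_happens'[OF trivial_limit_at_right_real] by blast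
  then show ?thesis by (intro that[of \<gamma>]) (auto simp: F_def P_def S_def Q_def)
qed

lemma exponential_stability:
  assumes A1: "A < 1"
    and contr: "(\<alpha> + (\<Sum>k\<in>J. \<rho> k * \<theta> k)) * ((\<Sum>k=1..m. \<beta> k) / (1 - A)) + (\<Sum>k\<in>{1..m} - J. \<rho> k) < 1"
  shows "exponentially_stable t0 m a g b h"
proof -
  define P S Q R where "P = \<alpha> + (\<Sum>k\<in>J. \<rho> k * \<theta> k)" and "S = (\<Sum>k=1..m. \<beta> k)"
    and "Q = (\<Sum>k\<in>{1..m} - J. \<rho> k)" and "R = (\<Sum>k\<in>J. \<rho> k)"
  have nn: "0 \<le> P" "0 \<le> S" "0 \<le> Q" "0 \<le> R"
    unfolding P_def S_def Q_def R_def using nonneg J \<alpha>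
    by (auto intro!: add_nonneg_nonneg sum_nonneg mult_nonneg_nonneg)
  obtain \<gamma> where \<gamma>: "0 < \<gamma>" "\<gamma> < b0" "A * exp (\<gamma> * L) < 1"
    and F: "\<gamma> / b0 + P * exp (\<gamma> * L) * (S * exp (\<gamma> * L) / (1 - A * exp (\<gamma> * L))) + Q * exp (\<gamma> * L) < 1"
    unfolding P_def S_def Q_def by (rule exists_decay_rate[OF A1 contr])
  define q where "q = exp (\<gamma> * L)"
  have "q > 0" by (simp add: q_def)
  \<comment> \<open>Solving the derivative estimate for \<open>W\<close> gives
    \<open>W \<le> c1 * Y + c2 * D\<close>; \<open>c3\<close> collects the coefficients of
    \<open>D\<close> in \<open>forcing\<close>. Below, \<kappa> is the resulting total coefficient
    of \<open>Y\<close>, and \<open>M\<close> solves the inequality for \<open>Y\<close>.\<close>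
  define c1 c2 c3 where "c1 = S * q / (1 - A * q)" and "c2 = (S * q + A * q) / (1 - A * q)"
    and "c3 = \<alpha> * q + 2 * q * R + Q * q"
  define \<kappa> where "\<kappa> = \<gamma> / b0 + P * q * c1 + Q * q"
  define M where "M = (P * q * c2 + c3 + 1) / (1 - \<kappa>)"
  have Aq: "A * q < 1" using \<gamma> by (simp add: q_def)
  have \<kappa>: "\<kappa> < 1" using F by (simp add: \<kappa>_def q_def c1_def)
  have "0 \<le> P * q * c2 + c3"
    using nn \<open>q > 0\<close> Aq A \<alpha> by (simp add: c2_def c3_def)
  then have "M > 0" using \<kappa> by (simp add: M_def)
  have bound: "exp (\<gamma> * (T - \<sigma>)) * \<bar>x T\<bar> \<le> M * D"
    if sol: "neutral_solution m a g b h \<sigma> \<phi> \<psi> x" and \<sigma>: "t0 \<le> \<sigma>" "\<sigma> \<le> T"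
      and \<phi>: "\<And>s. s \<le> \<sigma> \<Longrightarrow> \<bar>\<phi> s\<bar> \<le> D" and \<psi>: "\<And>s. s < \<sigma> \<Longrightarrow> \<bar>\<psi> s\<bar> \<le> D"
    for \<sigma> T D \<phi> \<psi> x
  proof -
    have "continuous_on {\<sigma>..T} (\<lambda>t. exp (\<gamma> * (t - \<sigma>)) * \<bar>x t\<bar>)"
      using sol \<sigma> by (intro continuous_intros abs_continuous_on_interval_imp_continuous_on)
        (auto simp: neutral_solution_def)
    then obtain y where y: "y \<in> {\<sigma>..T}"
      and max: "\<And>t. t \<in> {\<sigma>..T} \<Longrightarrow> exp (\<gamma> * (t - \<sigma>)) * \<bar>x t\<bar> \<le> exp (\<gamma> * (y - \<sigma>)) * \<bar>x y\<bar>"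
      using continuous_attains_sup[of "{\<sigma>..T}" "\<lambda>t. exp (\<gamma> * (t - \<sigma>)) * \<bar>x t\<bar>"] \<sigma> by auto
    \<comment> \<open>\<open>Y\<close> is the attained maximum, so an estimate at the single point
      \<open>y\<close> bounds \<open>Y\<close> itself.\<close>
    define Y where "Y = exp (\<gamma> * (y - \<sigma>)) * \<bar>x y\<bar>"
    obtain K where K: "AE t in lebesgue_on {\<sigma>..T}. \<bar>deriv x t\<bar> \<le> K"
      using sol \<sigma> by (auto simp: neutral_solution_def ess_bounded_on_def)
    \<comment> \<open>This crude bound may depend on \<open>T\<close> and on the solution; it only
      ensures that a least bound \<open>W\<close> exists.\<close>
    have "AE t in lebesgue_on {\<sigma>..T}. exp (\<gamma> * (t - \<sigma>)) * \<bar>deriv x t\<bar> \<le> exp (\<gamma> * (T - \<sigma>)) * \<bar>K\<bar>"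
      using K
    proof (rule AE_mp, intro AE_I2 impI mult_mono)
      fix t assume "t \<in> space (lebesgue_on {\<sigma>..T})"
      then show "exp (\<gamma> * (t - \<sigma>)) \<le> exp (\<gamma> * (T - \<sigma>))" using \<gamma> by simp
    qed auto
    then obtain W where W: "0 \<le> W" "AE t in lebesgue_on {\<sigma>..T}. exp (\<gamma> * (t - \<sigma>)) * \<bar>deriv x t\<bar> \<le> W"
      and least: "\<And>K. 0 \<le> K \<Longrightarrow> AE t in lebesgue_on {\<sigma>..T}. exp (\<gamma> * (t - \<sigma>)) * \<bar>deriv x t\<bar> \<le> K \<Longrightarrow> W \<le> K"
      by (rule least_AE_bound) (simp, rule that)
    interpret neutral_trajectory t0 b0 B L A \<alpha> r m J a g bJ b h \<beta> \<rho> \<theta> \<sigma> T \<gamma> D Y W q \<phi> \<psi> x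
    proof unfold_locales
      show "exp (\<gamma> * (t - \<sigma>)) * \<bar>x t\<bar> \<le> Y" if "t \<in> {\<sigma>..T}" for t
        unfolding Y_def by (rule max[OF that])
      show "AE t in lebesgue. t \<in> {\<sigma>..T} \<longrightarrow> exp (\<gamma> * (t - \<sigma>)) * \<bar>deriv x t\<bar> \<le> W"
        using W(2) by (simp add: AE_restrict_space_iff)
    qed (fact sol \<sigma> less_imp_le[OF \<gamma>(1)] q_def \<phi> \<psi> W(1))+
    \<comment> \<open>Minimality turns the a.e. estimate of the derivative into an inequality for
      \<open>W\<close> itself, and \<open>A * q < 1\<close> lets the term with \<open>W\<close> move
      to the left.\<close>
    have "W \<le> A * q * (W + D) + S * q * (Y + D)"
      unfolding S_def
    proof (rule least)
      show "0 \<le> A * q * (W + D) + (\<Sum>k=1..m. \<beta> k) * q * (Y + D)"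
        using A nn W_nonneg D_nonneg Y_nonneg \<open>q > 0\<close> unfolding S_def[symmetric]
        by (intro add_nonneg_nonneg mult_nonneg_nonneg) auto
      show "AE t in lebesgue_on {\<sigma>..T}. exp (\<gamma> * (t - \<sigma>)) * \<bar>deriv x t\<bar>
          \<le> A * q * (W + D) + (\<Sum>k=1..m. \<beta> k) * q * (Y + D)"
        using weighted_derivative_bound by (simp add: AE_restrict_space_iff)
    qed
    then have "W * (1 - A * q) \<le> S * q * Y + (S * q + A * q) * D"
      by (simp add: algebra_simps)
    then have "W \<le> (S * q * Y + (S * q + A * q) * D) / (1 - A * q)"
      using Aq by (simp add: pos_le_divide_eq)
    then have W_le: "W \<le> c1 * Y + c2 * D"
      by (simp add: c1_def c2_def add_divide_distrib distrib_right)
    have "forcing = P * q * W + c3 * D + Q * q * Y"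
    proof -
      have "(\<Sum>k\<in>J. \<rho> k * (q * W * \<theta> k + 2 * q * D))
          = (\<Sum>k\<in>J. q * W * (\<rho> k * \<theta> k) + 2 * q * D * \<rho> k)"
        by (intro sum.cong refl) (simp add: algebra_simps)
      also have "\<dots> = q * W * (\<Sum>k\<in>J. \<rho> k * \<theta> k) + 2 * q * D * R"
        by (simp only: R_def sum.distrib sum_distrib_left)
      finally have "(\<Sum>k\<in>J. \<rho> k * (q * W * \<theta> k + 2 * q * D))
          = q * W * (\<Sum>k\<in>J. \<rho> k * \<theta> k) + 2 * q * D * R" .
      moreover have "(\<Sum>k\<in>{1..m} - J. \<rho> k * (q * (Y + D))) = Q * (q * (Y + D))"
        by (simp only: Q_def sum_distrib_right)
      ultimately show ?thesis
        unfolding forcing_def P_def c3_def by (simp only: algebra_simps)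
    qed
    also have "\<dots> \<le> P * q * (c1 * Y + c2 * D) + c3 * D + Q * q * Y"
      using mult_left_mono[OF W_le, of "P * q"] nn \<open>q > 0\<close> by simp
    finally have "(1 - \<gamma> / b0) * Y \<le> P * q * (c1 * Y + c2 * D) + c3 * D + Q * q * Y + D"
      using weighted_value_bound[OF \<open>\<gamma> < b0\<close> y] by (simp add: Y_def)
    then have "Y * (1 - \<kappa>) \<le> (P * q * c2 + c3 + 1) * D"
      by (simp add: \<kappa>_def algebra_simps)
    then have "Y \<le> M * D"
      using \<kappa> by (simp add: M_def pos_le_divide_eq)
    then show ?thesis using max[of T] \<sigma> by (simp add: Y_def)
  qed
  show ?thesis
    unfolding exponentially_stable_def
  proof (rule exI[of _ M], intro conjI \<open>M > 0\<close>, rule exI[of _ \<gamma>], intro conjI \<open>0 < \<gamma>\<close> allI impI)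
    fix \<sigma> t and \<phi> \<psi> x :: "real \<Rightarrow> real"
    assume \<sigma>: "t0 \<le> \<sigma>" and init: "initial_data \<sigma> \<phi> \<psi>"
      and sol: "neutral_solution m a g b h \<sigma> \<phi> \<psi> x" and t: "\<sigma> \<le> t"
    \<comment> \<open>Boundedness of the initial data makes the range of \<open>d\<close> bounded
      above, so its real supremum can serve as \<open>D\<close>.\<close>
    define d where "d s = \<bar>\<phi> s\<bar> + (if s < \<sigma> then \<bar>\<psi> s\<bar> else 0)" for s
    obtain K1 K2 where K: "\<And>s. s \<le> \<sigma> \<Longrightarrow> \<bar>\<phi> s\<bar> \<le> K1" "\<And>s. s < \<sigma> \<Longrightarrow> \<bar>\<psi> s\<bar> \<le> K2"
      using init by (auto simp: initial_data_def bounded_iff)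
    have "d s \<le> K1 + \<bar>K2\<bar>" if "s \<le> \<sigma>" for s
      unfolding d_def using K(1)[OF that] K(2)[of s] by (intro add_mono) auto
    then have "bdd_above (d ` {..\<sigma>})"
      by (intro bdd_aboveI2[where M = "K1 + \<bar>K2\<bar>"]) simp
    then have le: "d s \<le> (SUP s\<in>{..\<sigma>}. d s)" if "s \<le> \<sigma>" for s
      using that by (intro cSUP_upper) auto
    have "exp (\<gamma> * (t - \<sigma>)) * \<bar>x t\<bar> \<le> M * (SUP s\<in>{..\<sigma>}. d s)"
    proof (rule bound[OF sol \<sigma> t])
      show "\<bar>\<phi> s\<bar> \<le> (SUP s\<in>{..\<sigma>}. d s)" if "s \<le> \<sigma>" for s
        using le[OF that] by (auto simp: d_def split: if_splits)
      show "\<bar>\<psi> s\<bar> \<le> (SUP s\<in>{..\<sigma>}. d s)" if "s < \<sigma>" for s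
        using le[of s] that by (auto simp: d_def split: if_splits)
    qed
    then have "exp (- \<gamma> * (t - \<sigma>)) * (exp (\<gamma> * (t - \<sigma>)) * \<bar>x t\<bar>)
        \<le> exp (- \<gamma> * (t - \<sigma>)) * (M * (SUP s\<in>{..\<sigma>}. d s))"
      by (rule mult_left_mono) simp
    then have "\<bar>x t\<bar> \<le> exp (- \<gamma> * (t - \<sigma>)) * (M * (SUP s\<in>{..\<sigma>}. d s))"
      by (simp add: mult.assoc[symmetric] exp_add[symmetric])
    then show "\<bar>x t\<bar> \<le> M * exp (- \<gamma> * (t - \<sigma>)) *
        (SUP s\<in>{..\<sigma>}. \<bar>\<phi> s\<bar> + (if s < \<sigma> then \<bar>\<psi> s\<bar> else 0))"
      by (simp add: d_def mult_ac)
  qed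
qed

end

section \<open>Passage from the norm hypotheses to the abstract constants\<close>

theorem theorem5p6:
  fixes t0 a0 b0 B \<delta> :: real and m :: nat and J :: "nat set"
    and a g bJ :: "real \<Rightarrow> real" and b h :: "nat \<Rightarrow> real \<Rightarrow> real" and \<tau> :: "nat \<Rightarrow> real"
  assumes "t0 \<ge> 0" and "m \<ge> 1"
    and "a \<in> borel_measurable (lebesgue_on {0..})"
    and "g \<in> borel_measurable (lebesgue_on {0..})"
    and "\<And>k. k \<in> {1..m} \<Longrightarrow> b k \<in> borel_measurable (lebesgue_on {0..})"
    and "\<And>k. k \<in> {1..m} \<Longrightarrow> h k \<in> borel_measurable (lebesgue_on {0..})"
    and "ess_bounded_on {0..} a"
    and "\<And>k. k \<in> {1..m} \<Longrightarrow> ess_bounded_on {0..} (b k)"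
    and "ess_norm t0 a \<le> a0" and "a0 < 1"
    and "\<And>k t. k \<in> {1..m} \<Longrightarrow> t \<ge> t0 \<Longrightarrow> b k t \<ge> 0"
    and "\<And>t. t \<ge> 0 \<Longrightarrow> 0 \<le> t - g t \<and> t - g t \<le> \<delta>"
    and "\<And>k t. k \<in> {1..m} \<Longrightarrow> t \<ge> 0 \<Longrightarrow> 0 \<le> t - h k t \<and> t - h k t \<le> \<tau> k"
    and "\<And>E. E \<in> null_sets lebesgue \<Longrightarrow> {t. t \<ge> 0 \<and> g t \<in> E} \<in> null_sets lebesgue"
    and "b0 > 0" and "J \<subseteq> {1..m}"
    and "\<And>t. bJ t = (\<Sum>k\<in>J. b k t)"
    and "\<And>t. t \<ge> t0 \<Longrightarrow> bJ t \<ge> b0"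
    and "B = (\<Sum>k\<in>J. ess_norm t0 (b k))"
    and "(ess_norm t0 (\<lambda>t. a t / bJ t)
            + (\<Sum>k\<in>J. ess_norm t0 (\<lambda>t. b k t / bJ t)
                      * ess_norm t0 (\<lambda>t. t - h k t - 1 / (B * exp 1))))
          * ((\<Sum>k=1..m. ess_norm t0 (b k)) / (1 - ess_norm t0 a))
          + (\<Sum>k\<in>{1..m} - J. ess_norm t0 (\<lambda>t. b k t / bJ t)) < 1"
  shows "exponentially_stable t0 m a g b h"
proof -
  note t0 = assms(1) and a_bdd = assms(7) and b_bdd = assms(8) and b_nn = assms(11)
    and bJ_def = assms(17) and bJ_ge = assms(18)
  define r where "r = 1 / (B * exp 1)"
  \<comment> \<open>The sum serves as a common bound of all \<open>\<tau> k\<close>, which are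
    nonnegative by the delay conditions at 0. The absolute value of \<open>r\<close> is taken
    because \<open>B > 0\<close> is established only later.\<close>
  define L where "L = \<delta> + (\<Sum>k=1..m. \<tau> k) + \<bar>r\<bar>"
  have sub: "{t0..} \<subseteq> {0..}" using t0 by auto
  have \<delta>: "0 \<le> \<delta>" using assms(12)[of 0] by simp
  have \<tau>: "0 \<le> \<tau> k" if "k \<in> {1..m}" for k using assms(13)[OF that, of 0] by simp
  have \<tau>_le: "\<tau> k \<le> (\<Sum>k=1..m. \<tau> k)" if "k \<in> {1..m}" for k
    using that \<tau> by (intro member_le_sum) auto
  have \<tau>_sum: "0 \<le> (\<Sum>k=1..m. \<tau> k)" using \<tau> by (intro sum_nonneg)
  have bdd_a: "ess_bounded_on {t0..} a"
    by (rule ess_bounded_on_subset[OF a_bdd sub]) auto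
  have bdd_b: "ess_bounded_on {t0..} (b k)" if "k \<in> {1..m}" for k
    by (rule ess_bounded_on_subset[OF b_bdd[OF that] sub]) auto
  have "(\<lambda>t. \<Sum>k\<in>J. b k t) \<in> borel_measurable (lebesgue_on {t0..})"
    using bdd_b assms(16) by (intro borel_measurable_sum) (auto simp: ess_bounded_on_def)
  then have meas_bJ: "bJ \<in> borel_measurable (lebesgue_on {t0..})"
    by (simp add: bJ_def[abs_def])
  \<comment> \<open>The lower bound \<open>b0\<close> of \<open>bJ\<close> keeps quotients
    essentially bounded, so \<open>ess_norm\<close> is their true essential supremum.\<close>
  have bdd_quot: "ess_bounded_on {t0..} (\<lambda>t. f t / bJ t)" if f: "ess_bounded_on {t0..} f" for f
    unfolding ess_bounded_on_def
  proof
    show "(\<lambda>t. f t / bJ t) \<in> borel_measurable (lebesgue_on {t0..})"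
      using f meas_bJ by (intro borel_measurable_divide) (auto simp: ess_bounded_on_def)
    obtain K where "AE t in lebesgue_on {t0..}. \<bar>f t\<bar> \<le> K"
      using f by (auto simp: ess_bounded_on_def)
    then have "AE t in lebesgue_on {t0..}. \<bar>f t / bJ t\<bar> \<le> \<bar>K\<bar> / b0"
    proof (rule AE_mp, intro AE_I2 impI)
      fix t assume "t \<in> space (lebesgue_on {t0..})" and K: "\<bar>f t\<bar> \<le> K"
      then have "b0 \<le> bJ t" using bJ_ge by simp
      then have "\<bar>f t\<bar> / bJ t \<le> \<bar>K\<bar> / b0"
        using K \<open>b0 > 0\<close> by (intro frac_le) auto
      then show "\<bar>f t / bJ t\<bar> \<le> \<bar>K\<bar> / b0"
        using \<open>b0 \<le> bJ t\<close> \<open>b0 > 0\<close> by (simp add: abs_divide)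
    qed
    then show "\<exists>K. AE t in lebesgue_on {t0..}. \<bar>f t / bJ t\<bar> \<le> K" by blast
  qed
  have bdd_h: "ess_bounded_on {t0..} (\<lambda>t. t - h k t - r)" if k: "k \<in> {1..m}" for k
    unfolding ess_bounded_on_def
  proof
    have [measurable]: "h k \<in> borel_measurable (lebesgue_on {t0..})"
      using measurable_restrict_mono[OF assms(6)[OF k] sub] .
    have [measurable]: "(\<lambda>t. t) \<in> borel_measurable (lebesgue_on {t0..})"
      by (rule measurable_restrict_space1, rule measurable_completion) simp
    show "(\<lambda>t. t - h k t - r) \<in> borel_measurable (lebesgue_on {t0..})" by measurable
    have "\<bar>t - h k t - r\<bar> \<le> \<tau> k + \<bar>r\<bar>" if "t0 \<le> t" for t
      using assms(13)[OF k, of t] that t0 by auto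
    then show "\<exists>K. AE t in lebesgue_on {t0..}. \<bar>t - h k t - r\<bar> \<le> K"
      by (intro exI[of _ "\<tau> k + \<bar>r\<bar>"] AE_I2) simp
  qed
  have b_ae: "AE t in lebesgue. t0 \<le> t \<longrightarrow> b k t \<le> ess_norm t0 (b k)" if "k \<in> {1..m}" for k
    using AE_le_ess_norm[OF bdd_b[OF that]] by eventually_elim auto
  have bJ_ae: "AE t in lebesgue. t0 \<le> t \<longrightarrow> bJ t \<le> B"
  proof -
    have "AE t in lebesgue. \<forall>k\<in>J. t0 \<le> t \<longrightarrow> b k t \<le> ess_norm t0 (b k)"
      using assms(16) b_ae by (intro AE_finite_allI) (auto intro: finite_subset)
    then show ?thesis
      unfolding assms(19) bJ_def by (rule AE_mp) (auto intro!: AE_I2 sum_mono)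
  qed
  \<comment> \<open>Some \<open>t \<ge> t0\<close> satisfies \<open>bJ t \<le> B\<close>, while
    \<open>bJ t \<ge> b0\<close> everywhere there; this makes \<open>r\<close> a genuine positive
    delay.\<close>
  have "B \<ge> b0"
    using AE_lebesgue_atLeast_imp_ex[OF bJ_ae] bJ_ge by fastforce
  then have "B > 0" using \<open>b0 > 0\<close> by simp
  have quot_ae: "AE t in lebesgue. t0 \<le> t \<longrightarrow> \<bar>f t\<bar> \<le> ess_norm t0 (\<lambda>t. f t / bJ t) * bJ t"
    if "ess_bounded_on {t0..} f" for f
    using AE_le_ess_norm[OF bdd_quot[OF that]]
  proof (rule AE_mp, intro AE_I2 impI)
    fix t assume *: "t0 \<le> t \<longrightarrow> \<bar>f t / bJ t\<bar> \<le> ess_norm t0 (\<lambda>t. f t / bJ t)" "t0 \<le> t"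
    then have "bJ t > 0" using bJ_ge[of t] \<open>b0 > 0\<close> by simp
    then show "\<bar>f t\<bar> \<le> ess_norm t0 (\<lambda>t. f t / bJ t) * bJ t"
      using * by (simp add: abs_divide pos_divide_le_eq)
  qed
  interpret neutral_coefficients t0 b0 B L "ess_norm t0 a" "ess_norm t0 (\<lambda>t. a t / bJ t)" r m J a g bJ b h
    "\<lambda>k. ess_norm t0 (b k)" "\<lambda>k. ess_norm t0 (\<lambda>t. b k t / bJ t)" "\<lambda>k. ess_norm t0 (\<lambda>t. t - h k t - r)"
  proof
    show "r \<le> L" using \<delta> \<tau>_sum by (simp add: L_def)
    show "AE t in lebesgue. t0 \<le> t \<longrightarrow> b k t \<le> ess_norm t0 (\<lambda>t. b k t / bJ t) * bJ t" if "k \<in> {1..m}" for k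
      using quot_ae[OF bdd_b[OF that]] by eventually_elim auto
    show "h k t \<in> {t - L..t}" if "k \<in> {1..m}" "t0 \<le> t" for k t
    proof -
      have "0 \<le> t - h k t" "t - h k t \<le> \<tau> k" using assms(13)[OF that(1), of t] that(2) t0 by auto
      then show ?thesis using \<tau>_le[OF that(1)] \<delta> unfolding L_def atLeastAtMost_iff by linarith
    qed
    show "g t \<in> {t - L..t}" if "t0 \<le> t" for t
    proof -
      have "0 \<le> t - g t" "t - g t \<le> \<delta>" using assms(12)[of t] that t0 by auto
      then show ?thesis using \<tau>_sum unfolding L_def atLeastAtMost_iff by linarith
    qed
    \<comment> \<open>The exceptional points lie in the preimage under \<open>g\<close> of the null
      set where \<open>P\<close> may fail.\<close>
    show "AE t in lebesgue. t0 \<le> t \<longrightarrow> P (g t)" if P: "AE s in lebesgue. P s" for P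
    proof -
      obtain N where N: "N \<in> null_sets lebesgue" "{s. \<not> P s} \<subseteq> N"
        using P by (auto simp: eventually_ae_filter)
      show ?thesis
        by (rule AE_I'[OF assms(14)[OF N(1)]]) (use N(2) t0 in auto)
    qed
    show "0 \<le> ess_norm t0 (b k) \<and> 0 \<le> ess_norm t0 (\<lambda>t. b k t / bJ t) \<and> 0 \<le> ess_norm t0 (\<lambda>t. t - h k t - r)"
      if "k \<in> {1..m}" for k
      using that by (intro conjI ess_norm_nonneg bdd_b bdd_quot bdd_h)
  qed (fact assms(15) \<open>B > 0\<close> assms(16) r_def bJ_ae bJ_def bJ_ge b_nn b_ae
      | (intro ess_norm_nonneg AE_le_ess_norm quot_ae bdd_a bdd_quot bdd_h, assumption?))+
  show ?thesis
    using assms(9,10,20) by (intro exponential_stability) (auto simp: r_def)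
qed

end
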